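(* Let $K$ be a field, let $P=K[x_1,\dots,x_n]$, $X=(x_1,\dots,x_n)$, $\mathfrak{M}=\langle x_1,\dots,x_n\rangle$, and let $I=\langle f_1,\dots,f_r\rangle$ be an ideal of $P$ with $f_i\in\mathfrak{M}$ such that each linear part $\ell_i=\mathrm{Lin}_{\mathfrak{M}}(f_i)$ is of the form $\ell_i=a_i x_{i_1}+b_i x_{i_2}$ with $a_i,b_i\in K$ and $i_1,i_2\in\{1,\dots,n\}$. Let $Z$ be a tuple of distinct indeterminates from $X$ (of length at least $1$) such that there exists a $Z$-separating re-embedding of $I$ (i.e., such that $I$ is $Z$-separating), and let $Y=X\setminus Z$. (a) The basic indeterminates of $X$ are contained in $Y$. (b) Each proper (cotangent) equivalence class in $X$ contains at least one element of $Y$. (c) If $\#Z=\dim_K(\mathrm{Lin}_{\mathfrak{M}}(I))$, then the $Z$-separating re-embedding of $I$ is optimal, the trivial indeterminates of $X$ are contained in $Z$, and each proper equivalence class in $X$ contains exactly one element of $Y$.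
   Context: For $f\in\mathfrak{M}$, $\mathrm{Lin}_{\mathfrak{M}}(f)$ is the homogeneous component of $f$ of standard degree $1$, and $\mathrm{Lin}_{\mathfrak{M}}(I)=\langle\mathrm{Lin}_{\mathfrak{M}}(f)\mid f\in I\rangle_K$, which equals $\langle\ell_1,\dots,\ell_r\rangle_K$. For a tuple $Z=(z_1,\dots,z_s)$ of distinct indeterminates, $I$ is $Z$-separating if there exist a term ordering $\sigma$ and $g_1,\dots,g_s\in I\setminus\{0\}$ with $\mathrm{LT}_\sigma(g_i)=z_i$ for $i=1,\dots,s$. In this case the reduced $\sigma$-Gröbner basis of $I$ has the form $\{z_1-h_1,\dots,z_s-h_s,p_1,\dots,p_t\}$ with $h_i,p_j\in K[Y]$, and the $Z$-separating re-embedding of $I$ is the $K$-algebra isomorphism $\Phi:P/I\to K[Y]/(I\cap K[Y])$ with $\Phi(\bar x_i)=\bar x_i$ for $x_i\in Y$ and $\Phi(\bar x_i)=\bar h_j$ for $x_i=z_j$. A re-embedding of $I$ is a $K$-algebra isomorphism $P/I\to P'/I'$ with a polynomial ring $P'$ over $K$ and an ideal $I'$ of $P'$; it is optimal if every $K$-algebra isomorphism $P/I\to P''/I''$ with a polynomial ring $P''$ over $K$ and an ideal $I''$ of $P''$ satisfies $\dim(P'')\ge\dim(P')$. Let $R=P/I$, let $\mathfrak{m}$ be the image of $\mathfrak{M}$ in $R$, and for $x_i\in X$ let $\bar x_i$ be its residue class in the cotangent space $\mathfrak{m}/\mathfrak{m}^2$. Cotangent equivalence is the equivalence relation on $X$ defined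 by $x_i\sim x_j\Leftrightarrow\langle\bar x_i\rangle_K=\langle\bar x_j\rangle_K$. An indeterminate $x_i$ is trivial if $\bar x_i=0$. A non-trivial indeterminate and its equivalence class are called basic if the class consists only of $x_i$, and proper if the class contains at least two elements. *)

theory Defs
  imports
    "HOL-Algebra.QuotRing"
    "HOL-Algebra.Ideal_Product"
    "HOL-Library.Poly_Mapping"
    "HOL-Library.Extended_Nat"
    "HOL-Library.FuncSet"
begin

text \<open>
  Indeterminates are identified with their indices (natural numbers). The type \<open>'k mpoly\<close> contains
  the polynomials in all indeterminates; the ring \<open>K[x\<^sub>i | i \<in> V]\<close> is \<open>poly_ring V\<close>, and ideals,
  cosets and quotients are those of HOL-Algebra, taken in this ring.
\<close>

type_synonym pp = "nat \<Rightarrow>\<^sub>0 nat"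
type_synonym 'k mpoly = "pp \<Rightarrow>\<^sub>0 'k"

definition const :: "'k::field \<Rightarrow> 'k mpoly" where
  "const c = Poly_Mapping.single 0 c"

definition pp_poly :: "pp \<Rightarrow> 'k::field mpoly" where
  "pp_poly t = Poly_Mapping.single t 1"

definition indet_pp :: "nat \<Rightarrow> pp" where
  "indet_pp i = Poly_Mapping.single i 1"

definition indet :: "nat \<Rightarrow> 'k::field mpoly" where
  "indet i = pp_poly (indet_pp i)"

definition pps :: "nat set \<Rightarrow> pp set" where
  "pps V = {t. Poly_Mapping.keys t \<subseteq> V}"

definition poly_ring :: "nat set \<Rightarrow> 'k::field mpoly ring" where
  "poly_ring V = \<lparr>carrier = {p. Poly_Mapping.keys p \<subseteq> pps V}, mult = (*), one = 1, zero = 0, add = (+)\<rparr>"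

definition irrelevant_ideal :: "nat set \<Rightarrow> 'k::field mpoly set" where
  "irrelevant_ideal V = Idl\<^bsub>poly_ring V\<^esub> (indet ` V)"

definition pp_degree :: "pp \<Rightarrow> nat" where
  "pp_degree t = (\<Sum>i\<in>Poly_Mapping.keys t. Poly_Mapping.lookup t i)"

definition hom_component :: "nat \<Rightarrow> 'k::field mpoly \<Rightarrow> 'k mpoly" where
  "hom_component d p =
     (\<Sum>t\<in>{t \<in> Poly_Mapping.keys p. pp_degree t = d}. Poly_Mapping.single t (Poly_Mapping.lookup p t))"

definition linear_part :: "'k::field mpoly \<Rightarrow> 'k mpoly" where
  "linear_part p = hom_component 1 p"

definition scale :: "'k::field \<Rightarrow> 'k mpoly \<Rightarrow> 'k mpoly" where
  "scale c p = const c * p"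

interpretation mpoly: vector_space "scale :: 'k::field \<Rightarrow> 'k mpoly \<Rightarrow> 'k mpoly"
  by unfold_locales
    (simp_all add: scale_def const_def algebra_simps single_add mult_single flip: mult.assoc)

definition linear_part_space :: "'k::field mpoly set \<Rightarrow> 'k mpoly set" where
  "linear_part_space I = mpoly.span (linear_part ` I)"

definition term_ordering :: "nat set \<Rightarrow> (pp \<times> pp) set \<Rightarrow> bool" where
  "term_ordering V \<sigma> \<longleftrightarrow>
     linear_order_on (pps V) \<sigma> \<and>
     (\<forall>t\<in>pps V. (0, t) \<in> \<sigma>) \<and>
     (\<forall>s t u. (s, t) \<in> \<sigma> \<longrightarrow> u \<in> pps V \<longrightarrow> (s + u, t + u) \<in> \<sigma>)"

definition LT :: "(pp \<times> pp) set \<Rightarrow> 'k::field mpoly \<Rightarrow> pp" where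
  "LT \<sigma> p = (THE t. t \<in> Poly_Mapping.keys p \<and> (\<forall>s\<in>Poly_Mapping.keys p. (s, t) \<in> \<sigma>))"

definition LC :: "(pp \<times> pp) set \<Rightarrow> 'k::field mpoly \<Rightarrow> 'k" where
  "LC \<sigma> p = Poly_Mapping.lookup p (LT \<sigma> p)"

definition LT_ideal :: "nat set \<Rightarrow> (pp \<times> pp) set \<Rightarrow> 'k::field mpoly set \<Rightarrow> 'k mpoly set" where
  "LT_ideal V \<sigma> F = Idl\<^bsub>poly_ring V\<^esub> ((\<lambda>f. pp_poly (LT \<sigma> f)) ` (F - {0}))"

definition groebner_basis ::
    "nat set \<Rightarrow> (pp \<times> pp) set \<Rightarrow> 'k::field mpoly set \<Rightarrow> 'k mpoly set \<Rightarrow> bool" where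
  "groebner_basis V \<sigma> I G \<longleftrightarrow> finite G \<and> G \<subseteq> I - {0} \<and> LT_ideal V \<sigma> G = LT_ideal V \<sigma> I"

definition reduced_groebner_basis ::
    "nat set \<Rightarrow> (pp \<times> pp) set \<Rightarrow> 'k::field mpoly set \<Rightarrow> 'k mpoly set \<Rightarrow> bool" where
  "reduced_groebner_basis V \<sigma> I G \<longleftrightarrow>
     groebner_basis V \<sigma> I G \<and>
     (\<forall>g\<in>G. LC \<sigma> g = 1 \<and> (\<forall>t\<in>Poly_Mapping.keys g. pp_poly t \<notin> LT_ideal V \<sigma> (G - {g})))"

text \<open>
  The ring \<open>poly_ring V Quot I\<close> carries the \<open>K\<close>-algebra structure given by the classes of the
  constants.
\<close>

definition K_algebra_iso ::
    "nat set \<Rightarrow> 'k::field mpoly set \<Rightarrow> nat set \<Rightarrow> 'k mpoly set \<Rightarrow> ('k mpoly set \<Rightarrow> 'k mpoly set) \<Rightarrow> bool" where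
  "K_algebra_iso V I V' I' \<phi> \<longleftrightarrow>
     \<phi> \<in> ring_iso (poly_ring V Quot I) (poly_ring V' Quot I') \<and>
     (\<forall>c. \<phi> (I +>\<^bsub>poly_ring V\<^esub> const c) = I' +>\<^bsub>poly_ring V'\<^esub> const c)"

definition reembedding ::
    "nat set \<Rightarrow> 'k::field mpoly set \<Rightarrow> nat set \<Rightarrow> 'k mpoly set \<Rightarrow> ('k mpoly set \<Rightarrow> 'k mpoly set) \<Rightarrow> bool" where
  "reembedding V I V' I' \<phi> \<longleftrightarrow>
     finite V' \<and> ideal I' (poly_ring V') \<and> K_algebra_iso V I V' I' \<phi>"

definition krull_dim :: "('a, 'b) ring_scheme \<Rightarrow> enat" where
  "krull_dim R = Sup {enat k | k. \<exists>\<pp>. (\<forall>i\<le>k. primeideal (\<pp> i) R) \<and> (\<forall>i<k. \<pp> i \<subset> \<pp> (Suc i))}"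

definition optimal_reembedding ::
    "nat set \<Rightarrow> 'k::field mpoly set \<Rightarrow> nat set \<Rightarrow> 'k mpoly set \<Rightarrow> ('k mpoly set \<Rightarrow> 'k mpoly set) \<Rightarrow> bool" where
  "optimal_reembedding V I V' I' \<phi> \<longleftrightarrow>
     reembedding V I V' I' \<phi> \<and>
     (\<forall>V'' I'' \<psi>. reembedding V I V'' I'' \<psi> \<longrightarrow>
        krull_dim (poly_ring V'' :: 'k mpoly ring) \<ge> krull_dim (poly_ring V' :: 'k mpoly ring))"

definition separating_for ::
    "nat set \<Rightarrow> (pp \<times> pp) set \<Rightarrow> 'k::field mpoly set \<Rightarrow> nat list \<Rightarrow> bool" where
  "separating_for V \<sigma> I Z \<longleftrightarrow>
     term_ordering V \<sigma> \<and> (\<forall>j<length Z. \<exists>g\<in>I - {0}. LT \<sigma> g = indet_pp (Z ! j))"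

definition separating :: "nat set \<Rightarrow> 'k::field mpoly set \<Rightarrow> nat list \<Rightarrow> bool" where
  "separating V I Z \<longleftrightarrow> (\<exists>\<sigma>. separating_for V \<sigma> I Z)"

abbreviation contracted_ideal :: "'k::field mpoly set \<Rightarrow> nat set \<Rightarrow> 'k mpoly set" where
  "contracted_ideal I Y \<equiv> I \<inter> carrier (poly_ring Y)"

definition is_separating_reembedding ::
    "nat set \<Rightarrow> 'k::field mpoly set \<Rightarrow> nat list \<Rightarrow> ('k mpoly set \<Rightarrow> 'k mpoly set) \<Rightarrow> bool" where
  "is_separating_reembedding V I Z \<Phi> \<longleftrightarrow>
     (let Y = V - set Z; P = poly_ring V; P' = poly_ring Y; I' = contracted_ideal I Y in
        \<Phi> \<in> extensional (carrier (P Quot I)) \<and>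
        K_algebra_iso V I Y I' \<Phi> \<and>
        (\<exists>\<sigma> h p. separating_for V \<sigma> I Z \<and>
           (\<forall>j<length Z. h j \<in> carrier P') \<and> p \<subseteq> carrier P' \<and>
           reduced_groebner_basis V \<sigma> I ((\<lambda>j. indet (Z ! j) - h j) ` {..<length Z} \<union> p) \<and>
           (\<forall>i\<in>Y. \<Phi> (I +>\<^bsub>P\<^esub> indet i) = I' +>\<^bsub>P'\<^esub> indet i) \<and>
           (\<forall>j<length Z. \<Phi> (I +>\<^bsub>P\<^esub> indet (Z ! j)) = I' +>\<^bsub>P'\<^esub> h j)))"

text \<open>
  The polynomials \<open>h j\<close> may depend on the term ordering, but their classes modulo the contracted
  ideal do not, so \<open>\<Phi>\<close> is determined by \<open>I\<close> and \<open>Z\<close>; extensionality makes the function itself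
  unique.
\<close>

definition separating_reembedding ::
    "nat set \<Rightarrow> 'k::field mpoly set \<Rightarrow> nat list \<Rightarrow> 'k mpoly set \<Rightarrow> 'k mpoly set" where
  "separating_reembedding V I Z = (THE \<Phi>. is_separating_reembedding V I Z \<Phi>)"

text \<open>
  The cotangent space \<open>\<mm>/\<mm>\<^sup>2\<close> of \<open>R = P/I\<close> is regarded as a subspace of the \<open>K\<close>-algebra
  \<open>R/\<mm>\<^sup>2\<close>, where a scalar \<open>c\<close> acts as multiplication by the class of the constant \<open>c\<close>.
\<close>

definition max_ideal_image :: "nat set \<Rightarrow> 'k::field mpoly set \<Rightarrow> 'k mpoly set set" where
  "max_ideal_image V I = (\<lambda>p. I +>\<^bsub>poly_ring V\<^esub> p) ` irrelevant_ideal V"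

definition max_ideal_square :: "nat set \<Rightarrow> 'k::field mpoly set \<Rightarrow> 'k mpoly set set" where
  "max_ideal_square V I =
     max_ideal_image V I \<cdot>\<^bsub>poly_ring V Quot I\<^esub> max_ideal_image V I"

definition mod_square_ring :: "nat set \<Rightarrow> 'k::field mpoly set \<Rightarrow> 'k mpoly set set ring" where
  "mod_square_ring V I = (poly_ring V Quot I) Quot (max_ideal_square V I)"

definition mod_square_class :: "nat set \<Rightarrow> 'k::field mpoly set \<Rightarrow> 'k mpoly \<Rightarrow> 'k mpoly set set" where
  "mod_square_class V I p =
     max_ideal_square V I +>\<^bsub>poly_ring V Quot I\<^esub> (I +>\<^bsub>poly_ring V\<^esub> p)"

definition cotangent_line :: "nat set \<Rightarrow> 'k::field mpoly set \<Rightarrow> nat \<Rightarrow> 'k mpoly set set set" where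
  "cotangent_line V I i =
     {mod_square_class V I (const c) \<otimes>\<^bsub>mod_square_ring V I\<^esub> mod_square_class V I (indet i) | c. True}"

definition cotangent_equiv :: "nat set \<Rightarrow> 'k::field mpoly set \<Rightarrow> (nat \<times> nat) set" where
  "cotangent_equiv V I = {(i, j). i \<in> V \<and> j \<in> V \<and> cotangent_line V I i = cotangent_line V I j}"

definition trivial_indets :: "nat set \<Rightarrow> 'k::field mpoly set \<Rightarrow> nat set" where
  "trivial_indets V I = {i \<in> V. mod_square_class V I (indet i) = \<zero>\<^bsub>mod_square_ring V I\<^esub>}"

definition basic_indets :: "nat set \<Rightarrow> 'k::field mpoly set \<Rightarrow> nat set" where
  "basic_indets V I = {i \<in> V - trivial_indets V I. cotangent_equiv V I `` {i} = {i}}"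

definition proper_classes :: "nat set \<Rightarrow> 'k::field mpoly set \<Rightarrow> nat set set" where
  "proper_classes V I =
     {C \<in> V // cotangent_equiv V I. C \<inter> trivial_indets V I = {} \<and> card C \<ge> 2}"

end

theory Submission
  imports Defs
begin

text \<open>
  Write \<open>L\<close> for the space of linear parts of \<open>I\<close>, so that the cotangent space is the span of the
  indeterminates modulo \<open>L\<close>. Since \<open>L\<close> is spanned by binomials, a non-trivial equivalence class \<open>C\<close>
  with a chosen \<open>z \<in> C\<close> carries the functional \<open>p \<mapsto> \<Sum>y\<in>C. l y * coeff p y\<close>, where \<open>y \<equiv> l y * z\<close>
  modulo \<open>L\<close>; it vanishes on \<open>I\<close>. If \<open>C\<close> were contained in \<open>Z\<close> and \<open>z\<close> were \<open>\<sigma>\<close>-least in \<open>C\<close>, then an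
  element of \<open>I\<close> with leading term \<open>z\<close> would have a non-zero value, a contradiction. This gives (a)
  and (b).

  For (c), \<open>Y\<close> always spans the cotangent space, whose dimension is \<open>n - dim L\<close>; if \<open>#Z = dim L\<close>, then
  \<open>Y\<close> is a basis of it, so it contains no trivial and no two equivalent indeterminates. The linear
  parts of representatives of the generators of any re-embedding also span the cotangent space, so
  no re-embedding has fewer than \<open>#Y\<close> indeterminates. The separating re-embedding itself maps a coset
  \<open>C\<close> of \<open>I\<close> to \<open>C \<inter> K[Y]\<close>; the required reduced Groebner basis consists of \<open>m\<close> minus its normal form,
  for the minimal leading terms \<open>m\<close>.
\<close>

section \<open>Polynomial rings\<close>

abbreviation coeff :: "('a \<Rightarrow>\<^sub>0 'b::zero) \<Rightarrow> 'a \<Rightarrow> 'b" where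
  "coeff \<equiv> Poly_Mapping.lookup"

abbreviation keys :: "('a \<Rightarrow>\<^sub>0 'b::zero) \<Rightarrow> 'a set" where
  "keys \<equiv> Poly_Mapping.keys"

lemma zero_in_pps [simp]: "0 \<in> pps V"
  by (simp add: pps_def)

lemma add_in_pps: "s \<in> pps V \<Longrightarrow> t \<in> pps V \<Longrightarrow> s + t \<in> pps V"
  using keys_add[of s t] by (auto simp: pps_def)

lemma indet_pp_in_pps [simp]: "indet_pp i \<in> pps V \<longleftrightarrow> i \<in> V"
  by (simp add: pps_def indet_pp_def)

lemma indet_pp_inject [simp]: "indet_pp i = indet_pp j \<longleftrightarrow> i = j"
  unfolding indet_pp_def by (metis keys_single one_neq_zero singleton_inject)

lemma indet_pp_nonzero [simp]: "indet_pp i \<noteq> 0" "0 \<noteq> indet_pp i"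
  unfolding indet_pp_def by (metis keys_single keys_zero insert_not_empty one_neq_zero)+

lemma carrier_poly_ring: "carrier (poly_ring V) = {p. keys p \<subseteq> pps V}"
  and mult_poly_ring [simp]: "mult (poly_ring V) = (*)"
  and one_poly_ring [simp]: "one (poly_ring V) = 1"
  and zero_poly_ring [simp]: "zero (poly_ring V) = 0"
  and add_poly_ring [simp]: "add (poly_ring V) = (+)"
  by (simp_all add: poly_ring_def)

lemma pp_poly_in_carrier [simp]: "(pp_poly t :: 'k::field mpoly) \<in> carrier (poly_ring V) \<longleftrightarrow> t \<in> pps V"
  by (simp add: carrier_poly_ring pp_poly_def)

lemma const_in_carrier [simp]: "const c \<in> carrier (poly_ring V)"
  by (auto simp: carrier_poly_ring const_def)

lemma indet_in_carrier [simp]: "(indet i :: 'k::field mpoly) \<in> carrier (poly_ring V) \<longleftrightarrow> i \<in> V"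
  by (simp add: indet_def)

lemma const_0 [simp]: "const 0 = 0" and const_1 [simp]: "const 1 = 1"
  by (simp_all add: const_def)

lemma const_mult: "const (c * d) = const c * const d"
  and const_add: "const (c + d) = const c + const d"
  and const_uminus: "const (- c) = - const c"
  by (simp_all add: const_def mult_single single_add single_uminus)

lemma poly_ring_closed [simp]:
  fixes p q :: "'k::field mpoly"
  shows "(0 :: 'k mpoly) \<in> carrier (poly_ring V)" "(1 :: 'k mpoly) \<in> carrier (poly_ring V)"
    and "p \<in> carrier (poly_ring V) \<Longrightarrow> - p \<in> carrier (poly_ring V)"
    and "p \<in> carrier (poly_ring V) \<Longrightarrow> q \<in> carrier (poly_ring V) \<Longrightarrow> p + q \<in> carrier (poly_ring V)"
    and "p \<in> carrier (poly_ring V) \<Longrightarrow> q \<in> carrier (poly_ring V) \<Longrightarrow> p - q \<in> carrier (poly_ring V)"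
    and "p \<in> carrier (poly_ring V) \<Longrightarrow> q \<in> carrier (poly_ring V) \<Longrightarrow> p * q \<in> carrier (poly_ring V)"
proof -
  show "(0 :: 'k mpoly) \<in> carrier (poly_ring V)" "(1 :: 'k mpoly) \<in> carrier (poly_ring V)"
    by (simp_all add: carrier_poly_ring)
  show "- p \<in> carrier (poly_ring V)" if "p \<in> carrier (poly_ring V)"
    using that by (auto simp: carrier_poly_ring in_keys_iff)
  show "p + q \<in> carrier (poly_ring V)"
    if "p \<in> carrier (poly_ring V)" "q \<in> carrier (poly_ring V)"
    using that keys_add[of p q] by (auto simp: carrier_poly_ring)
  show "p - q \<in> carrier (poly_ring V)"
    if "p \<in> carrier (poly_ring V)" "q \<in> carrier (poly_ring V)"
    using that by (auto simp: carrier_poly_ring in_keys_iff lookup_minus subset_iff) (metis diff_self)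
  show "p * q \<in> carrier (poly_ring V)"
    if "p \<in> carrier (poly_ring V)" "q \<in> carrier (poly_ring V)"
    using that keys_mult[of p q] add_in_pps by (fastforce simp: carrier_poly_ring)
qed

lemma sum_in_carrier:
  "(\<And>i. i \<in> A \<Longrightarrow> f i \<in> carrier (poly_ring V)) \<Longrightarrow> sum f A \<in> carrier (poly_ring V)"
  by (induction A rule: infinite_finite_induct) auto

lemma cring_poly_ring: "cring (poly_ring V :: 'k::field mpoly ring)"
proof (rule cringI)
  show "abelian_group (poly_ring V :: 'k mpoly ring)"
  proof (rule abelian_groupI; simp add: algebra_simps)
    fix p :: "'k mpoly"
    assume "p \<in> carrier (poly_ring V)"
    then show "\<exists>q\<in>carrier (poly_ring V). p + q = 0"
      by (intro bexI[of _ "- p"]) auto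
  qed
  show "comm_monoid (poly_ring V :: 'k mpoly ring)"
    by (rule comm_monoidI) (simp_all add: algebra_simps)
qed (simp add: algebra_simps)

lemma ring_poly_ring: "ring (poly_ring V :: 'k::field mpoly ring)"
  using cring_poly_ring by (rule cring.axioms)

lemma pp_poly_add: "pp_poly (s + t) = pp_poly s * (pp_poly t :: 'k::field mpoly)"
  by (simp add: pp_poly_def mult_single)

lemma pp_poly_0 [simp]: "pp_poly 0 = 1"
  by (simp add: pp_poly_def)

lemma const_mult_pp_poly: "const c * pp_poly t = Poly_Mapping.single t c"
  by (simp add: const_def pp_poly_def mult_single)

lemma poly_expansion: "p = (\<Sum>t\<in>keys p. const (coeff p t) * pp_poly t)"
  by (rule poly_mapping_eqI)
    (auto simp: lookup_sum const_mult_pp_poly lookup_single when_def in_keys_iff)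

text \<open>Induction on the total degree: a non-trivial term is divisible by some indeterminate,
  and dividing by it lowers the degree.\<close>

lemma pp_induct [consumes 1, case_names zero step]:
  assumes "t \<in> pps V" and "Q 0"
    and step: "\<And>s i. s \<in> pps V \<Longrightarrow> i \<in> V \<Longrightarrow> Q s \<Longrightarrow> Q (indet_pp i + s)"
  shows "Q t"
  using assms(1)
proof (induction "\<Sum>i\<in>keys t. coeff t i" arbitrary: t rule: less_induct)
  case less
  show ?case
  proof (cases "t = 0")
    case True
    then show ?thesis using assms(2) by simp
  next
    case False
    then obtain i where i: "i \<in> keys t"
      using keys_eq_empty by (metis all_not_in_conv poly_mapping_eqI lookup_zero in_keys_iff)
    \<comment> \<open>Subtraction of exponents is truncated at zero; since
      \<open>i \<in> keys t\<close>, nothing is cut off, and adding \<open>indet_pp i\<close> gives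
      \<open>t\<close> back.\<close>
    define s where "s = t - indet_pp i"
    have cs: "coeff s j = coeff t j - (if j = i then 1 else 0)" for j
      by (simp add: s_def indet_pp_def lookup_minus lookup_single when_def)
    have ts: "t = indet_pp i + s"
    proof (rule poly_mapping_eqI)
      fix j show "coeff t j = coeff (indet_pp i + s) j"
        using i by (auto simp: lookup_add cs indet_pp_def lookup_single when_def in_keys_iff)
    qed
    have sub: "keys s \<subseteq> keys t"
      using cs by (auto simp: in_keys_iff)
    have "(\<Sum>j\<in>keys s. coeff s j) = (\<Sum>j\<in>keys t. coeff s j)"
      using sub by (intro sum.mono_neutral_left) (auto simp: in_keys_iff)
    also have "\<dots> < (\<Sum>j\<in>keys t. coeff t j)"
      using i by (intro sum_strict_mono_ex1) (auto simp: cs in_keys_iff)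
    finally have "(\<Sum>j\<in>keys s. coeff s j) < (\<Sum>j\<in>keys t. coeff t j)" .
    moreover have "s \<in> pps V" "i \<in> V"
      using less.prems sub i by (auto simp: pps_def)
    ultimately show ?thesis using less.hyps step ts by metis
  qed
qed

text \<open>Constants and indeterminates generate K[V] as a ring. This rule serves below wherever a
  property is extended from these generators to all of K[V].\<close>

lemma poly_ring_induct [consumes 1, case_names const indet add mult]:
  fixes p :: "'k::field mpoly"
  assumes "p \<in> carrier (poly_ring V)"
    and const: "\<And>c. Q (const c)"
    and indet: "\<And>i. i \<in> V \<Longrightarrow> Q (indet i)"
    and add: "\<And>p q. p \<in> carrier (poly_ring V) \<Longrightarrow> q \<in> carrier (poly_ring V) \<Longrightarrow> Q p \<Longrightarrow> Q q \<Longrightarrow> Q (p + q)"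
    and mult: "\<And>p q. p \<in> carrier (poly_ring V) \<Longrightarrow> q \<in> carrier (poly_ring V) \<Longrightarrow> Q p \<Longrightarrow> Q q \<Longrightarrow> Q (p * q)"
  shows "Q p"
proof -
  have mono: "Q (pp_poly t)" if "t \<in> pps V" for t
    using that
  proof (induction rule: pp_induct)
    case zero
    then show ?case using const[of 1] by simp
  next
    case (step s i)
    then show ?case using mult[of "indet i" "pp_poly s"] indet[of i]
      by (simp add: pp_poly_add indet_def)
  qed
  \<comment> \<open>Partial sums over subsets of the support allow induction on finite sets; the
    empty sum is \<open>const 0\<close>.\<close>
  have "Q (\<Sum>t\<in>A. const (coeff p t) * pp_poly t)" if "A \<subseteq> keys p" for A
    using finite_subset[OF that finite_keys] that
  proof (induction A rule: finite_induct)
    case empty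
    then show ?case using const[of 0] by simp
  next
    case (insert t A)
    have t: "t \<in> pps V" and A: "\<And>s. s \<in> A \<Longrightarrow> s \<in> pps V"
      using insert.prems assms(1) by (auto simp: carrier_poly_ring)
    show ?case
      using insert t A mono[OF t] const
      by (simp add: add mult sum_in_carrier)
  qed
  from this[of "keys p"] show ?thesis
    by (simp flip: poly_expansion)
qed

section \<open>Coefficients of products at the constant and the linear terms\<close>

lemma coeff_const: "coeff (const c) t = (if t = 0 then c else 0)"
  by (auto simp: const_def lookup_single when_def)

lemma coeff_pp_poly: "coeff (pp_poly s) t = (if t = s then 1 else 0)"
  by (auto simp: pp_poly_def lookup_single when_def)

lemma coeff_indet: "coeff (indet i) t = (if t = indet_pp i then 1 else 0)"
  by (simp add: indet_def coeff_pp_poly)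

lemma coeff_const_mult [simp]: "coeff (const c * p) t = c * coeff p t"
proof -
  have "coeff (const c * p) t = (\<Sum>s. c * (\<Sum>q. coeff p q when t = s + q) when s = 0)"
    unfolding lookup_mult by (rule Sum_any.cong) (auto simp: coeff_const when_def)
  then show ?thesis by simp
qed

text \<open>Exponents are natural numbers: at \<open>i\<close> they add up to 1 and elsewhere to 0,
  so one factor must be trivial. This is what makes linear coefficients obey the Leibniz
  rule.\<close>

lemma sum_is_indet_pp:
  "s + t = indet_pp i \<longleftrightarrow> (s = 0 \<and> t = indet_pp i) \<or> (s = indet_pp i \<and> t = 0)"
proof
  assume eq: "s + t = indet_pp i"
  then have sum: "coeff s j + coeff t j = (if j = i then 1 else 0)" for j
    using lookup_add[of s t j] by (auto simp: indet_pp_def lookup_single when_def)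
  have oth: "coeff s j = 0 \<and> coeff t j = 0" if "j \<noteq> i" for j
    using sum[of j] that by simp
  have "coeff s i = 0 \<or> coeff t i = 0" using sum[of i] by auto
  then have "s = 0 \<or> t = 0"
    using oth by (metis poly_mapping_eqI lookup_zero)
  then show "(s = 0 \<and> t = indet_pp i) \<or> (s = indet_pp i \<and> t = 0)"
    using eq by auto
qed auto

lemma sum_is_zero_pp: "s + t = (0::pp) \<longleftrightarrow> s = 0 \<and> t = 0"
  by (metis add_eq_0_iff_both_eq_0 lookup_add lookup_zero poly_mapping_eqI add.right_neutral)

text \<open>Both arguments expand as finite sums of monomials, so biadditive maps are determined by
  their values on monomials. Identities about products are checked this way.\<close>

lemma bilinear_ext:
  fixes F G :: "'k::field mpoly \<Rightarrow> 'k mpoly \<Rightarrow> 'a::comm_monoid_add"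
  assumes "\<And>p p' q. F (p + p') q = F p q + F p' q" "\<And>p q q'. F p (q + q') = F p q + F p q'"
    and "\<And>p p' q. G (p + p') q = G p q + G p' q" "\<And>p q q'. G p (q + q') = G p q + G p q'"
    and "\<And>q. F 0 q = 0" "\<And>p. F p 0 = 0" "\<And>q. G 0 q = 0" "\<And>p. G p 0 = 0"
    and "\<And>s t c d. F (const c * pp_poly s) (const d * pp_poly t) = G (const c * pp_poly s) (const d * pp_poly t)"
  shows "F p q = G p q"
proof -
  have 1: "F (sum f A) q = (\<Sum>a\<in>A. F (f a) q) \<and> G (sum f A) q = (\<Sum>a\<in>A. G (f a) q)"
    if "finite A" for f :: "pp \<Rightarrow> 'k mpoly" and A q
    using that by induction (auto simp: assms)
  have 2: "F p (sum f A) = (\<Sum>a\<in>A. F p (f a)) \<and> G p (sum f A) = (\<Sum>a\<in>A. G p (f a))"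
    if "finite A" for f :: "pp \<Rightarrow> 'k mpoly" and A p
    using that by induction (auto simp: assms)
  show ?thesis
    by (subst (1 2) poly_expansion[of p], subst (1 2) poly_expansion[of q])
      (simp add: 1 2 assms(9))
qed

lemma coeff_mult_zero [simp]: "coeff (p * q) 0 = coeff p 0 * coeff (q :: 'k::field mpoly) 0"
  by (rule bilinear_ext[where F = "\<lambda>p q. coeff (p * q) 0" and G = "\<lambda>p q. coeff p 0 * coeff q 0"])
    (auto simp: lookup_add algebra_simps const_mult_pp_poly mult_single lookup_single when_def sum_is_zero_pp)

text \<open>Leibniz rule at the origin: the coefficient of an indeterminate is a derivation into K,
  where a polynomial acts on K by its constant term.\<close>

lemma coeff_mult_indet_pp:
  "coeff (p * q) (indet_pp i) = coeff p 0 * coeff q (indet_pp i) + coeff p (indet_pp i) * coeff (q :: 'k::field mpoly) 0"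
  by (rule bilinear_ext[where F = "\<lambda>p q. coeff (p * q) (indet_pp i)"
        and G = "\<lambda>p q. coeff p 0 * coeff q (indet_pp i) + coeff p (indet_pp i) * coeff q 0"])
    (auto simp: lookup_add algebra_simps const_mult_pp_poly mult_single lookup_single when_def sum_is_indet_pp)

section \<open>Ideals, cosets and linear parts\<close>

text \<open>Closure under negation comes from multiplication by \<open>const (- 1)\<close>.\<close>

lemma ideal_poly_ringI:
  fixes J :: "'k::field mpoly set"
  assumes "J \<subseteq> carrier (poly_ring V)" "0 \<in> J"
    and add: "\<And>p q. p \<in> J \<Longrightarrow> q \<in> J \<Longrightarrow> p + q \<in> J"
    and mult: "\<And>p q. p \<in> carrier (poly_ring V) \<Longrightarrow> q \<in> J \<Longrightarrow> p * q \<in> J"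
  shows "ideal J (poly_ring V)"
proof (rule idealI[OF ring_poly_ring])
  interpret ring "poly_ring V :: 'k mpoly ring" by (rule ring_poly_ring)
  show "subgroup J (add_monoid (poly_ring V))"
  proof (rule add.subgroupI)
    show "\<ominus>\<^bsub>poly_ring V\<^esub> p \<in> J" if "p \<in> J" for p
    proof -
      have "\<ominus>\<^bsub>poly_ring V\<^esub> p = - p"
        by (rule minus_equality) (use that assms(1) in auto)
      also have "\<dots> = const (- 1) * p" by (simp add: const_uminus)
      also have "\<dots> \<in> J" using that by (intro mult) auto
      finally show ?thesis .
    qed
  qed (use assms in auto)
  show "a \<otimes>\<^bsub>poly_ring V\<^esub> x \<in> J" if "a \<in> J" "x \<in> carrier (poly_ring V)" for a x
    using mult[OF that(2,1)] by (simp add: mult.commute)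
qed (use mult in auto)

lemma ideal_poly_ringD:
  fixes J :: "'k::field mpoly set"
  assumes "ideal J (poly_ring V)"
  shows "J \<subseteq> carrier (poly_ring V)" "0 \<in> J"
    and "p \<in> J \<Longrightarrow> q \<in> J \<Longrightarrow> p + q \<in> J"
    and "p \<in> carrier (poly_ring V) \<Longrightarrow> q \<in> J \<Longrightarrow> p * q \<in> J"
    and "p \<in> J \<Longrightarrow> - p \<in> J"
    and "p \<in> J \<Longrightarrow> q \<in> J \<Longrightarrow> p - q \<in> J"
proof -
  interpret ideal J "poly_ring V" by fact
  show "J \<subseteq> carrier (poly_ring V)" "0 \<in> J"
    using a_subset additive_subgroup.zero_closed[OF is_additive_subgroup] by simp_all
  show add: "\<And>p q. p \<in> J \<Longrightarrow> q \<in> J \<Longrightarrow> p + q \<in> J"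
    using additive_subgroup.a_closed[OF is_additive_subgroup] by simp
  show mult: "\<And>p q. p \<in> carrier (poly_ring V) \<Longrightarrow> q \<in> J \<Longrightarrow> p * q \<in> J"
    using I_l_closed by simp
  have uminus: "- p \<in> J" if "p \<in> J" for p
    using mult[OF _ that, of "const (- 1)"] by (simp add: const_uminus)
  then show "p \<in> J \<Longrightarrow> - p \<in> J" .
  show "p \<in> J \<Longrightarrow> q \<in> J \<Longrightarrow> p - q \<in> J"
    using add[of p "- q"] uminus[of q] by simp
qed

lemma ideal_sum:
  fixes J :: "'k::field mpoly set"
  assumes "ideal J (poly_ring V)" "\<And>a. a \<in> A \<Longrightarrow> f a \<in> J"
  shows "sum f A \<in> J"
  using assms(2) by (induction A rule: infinite_finite_induct) (auto simp: ideal_poly_ringD[OF assms(1)])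

lemma genideal_poly_ring:
  fixes S :: "'k::field mpoly set"
  assumes "S \<subseteq> carrier (poly_ring V)"
  shows "ideal (Idl\<^bsub>poly_ring V\<^esub> S) (poly_ring V)" "S \<subseteq> Idl\<^bsub>poly_ring V\<^esub> S"
  using ring.genideal_ideal[OF ring_poly_ring assms] ring.genideal_self[OF ring_poly_ring assms] .

lemma genideal_poly_ring_minimal:
  fixes S :: "'k::field mpoly set"
  shows "ideal J (poly_ring V) \<Longrightarrow> S \<subseteq> J \<Longrightarrow> Idl\<^bsub>poly_ring V\<^esub> S \<subseteq> J"
  by (rule ring.genideal_minimal[OF ring_poly_ring])

lemma coset_poly_ring: "J +>\<^bsub>poly_ring V\<^esub> p = (\<lambda>h. h + p) ` J"
  by (auto simp: a_r_coset_def r_coset_def)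

lemma coset_eq_iff:
  fixes J :: "'k::field mpoly set"
  assumes "ideal J (poly_ring V)"
  shows "J +>\<^bsub>poly_ring V\<^esub> p = J +>\<^bsub>poly_ring V\<^esub> q \<longleftrightarrow> p - q \<in> J"
proof
  assume "J +>\<^bsub>poly_ring V\<^esub> p = J +>\<^bsub>poly_ring V\<^esub> q"
  moreover have "p \<in> J +>\<^bsub>poly_ring V\<^esub> p"
    unfolding coset_poly_ring by (rule image_eqI[of _ _ 0]) (simp_all add: ideal_poly_ringD[OF assms])
  ultimately show "p - q \<in> J"
    by (auto simp: coset_poly_ring)
next
  assume pq: "p - q \<in> J"
  show "J +>\<^bsub>poly_ring V\<^esub> p = J +>\<^bsub>poly_ring V\<^esub> q"
  proof (intro equalityI subsetI)
    fix x assume "x \<in> J +>\<^bsub>poly_ring V\<^esub> p"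
    then obtain h where "h \<in> J" "x = h + p" by (auto simp: coset_poly_ring)
    then have "x = (h + (p - q)) + q" "h + (p - q) \<in> J"
      using pq by (auto simp: ideal_poly_ringD(3)[OF assms])
    then show "x \<in> J +>\<^bsub>poly_ring V\<^esub> q" unfolding coset_poly_ring by (rule image_eqI)
  next
    fix x assume "x \<in> J +>\<^bsub>poly_ring V\<^esub> q"
    then obtain h where "h \<in> J" "x = h + q" by (auto simp: coset_poly_ring)
    then have "x = (h - (p - q)) + p" "h - (p - q) \<in> J"
      using pq by (auto simp: ideal_poly_ringD(6)[OF assms])
    then show "x \<in> J +>\<^bsub>poly_ring V\<^esub> p" unfolding coset_poly_ring by (rule image_eqI)
  qed
qed

lemma carrier_quot_poly_ring:
  "carrier (poly_ring V Quot J) = (\<lambda>p. J +>\<^bsub>poly_ring V\<^esub> p) ` carrier (poly_ring V)"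
  by (auto simp: FactRing_def A_RCOSETS_def')

lemma quot_poly_ring_ops:
  fixes J :: "'k::field mpoly set"
  assumes "ideal J (poly_ring V)" "p \<in> carrier (poly_ring V)" "q \<in> carrier (poly_ring V)"
  shows "(J +>\<^bsub>poly_ring V\<^esub> p) \<oplus>\<^bsub>poly_ring V Quot J\<^esub> (J +>\<^bsub>poly_ring V\<^esub> q) = J +>\<^bsub>poly_ring V\<^esub> (p + q)"
    and "(J +>\<^bsub>poly_ring V\<^esub> p) \<otimes>\<^bsub>poly_ring V Quot J\<^esub> (J +>\<^bsub>poly_ring V\<^esub> q) = J +>\<^bsub>poly_ring V\<^esub> (p * q)"
  using ring_hom_add[OF ideal.rcos_ring_hom[OF assms(1)] assms(2,3)]
    ring_hom_mult[OF ideal.rcos_ring_hom[OF assms(1)] assms(2,3)] by simp_all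

text \<open>The right-hand side is the kernel of evaluation at the origin, an ideal containing the
  indeterminates. Conversely, removing the constant term of any polynomial leaves an element of the
  generated ideal.\<close>

lemma irrelevant_ideal_eq:
  "irrelevant_ideal V = {p \<in> carrier (poly_ring V). coeff (p :: 'k::field mpoly) 0 = 0}"
proof
  have "ideal {p \<in> carrier (poly_ring V). coeff (p :: 'k mpoly) 0 = 0} (poly_ring V)"
    by (rule ideal_poly_ringI) (auto simp: lookup_add)
  then show "irrelevant_ideal V \<subseteq> {p \<in> carrier (poly_ring V). coeff (p :: 'k mpoly) 0 = 0}"
    unfolding irrelevant_ideal_def
    by (rule genideal_poly_ring_minimal) (auto simp: coeff_indet)
next
  have sub: "indet ` V \<subseteq> carrier (poly_ring V :: 'k mpoly ring)" by auto
  note id = genideal_poly_ring[OF sub, folded irrelevant_ideal_def]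
  \<comment> \<open>Subtracting the constant term turns the claim into one about all polynomials,
    which passes through sums and products.\<close>
  have "p - const (coeff p 0) \<in> irrelevant_ideal V" if "p \<in> carrier (poly_ring V)" for p :: "'k mpoly"
    using that
  proof (induction rule: poly_ring_induct)
    case (const c)
    then show ?case using ideal_poly_ringD(2)[OF id(1)] by (simp add: coeff_const)
  next
    case (indet i)
    then show ?case using id(2) by (auto simp: coeff_indet)
  next
    case (add p q)
    then show ?case using ideal_poly_ringD(3)[OF id(1) add(3,4)]
      by (simp add: lookup_add const_add algebra_simps)
  next
    case (mult p q)
    have "p * q - const (coeff (p * q) 0) =
        p * (q - const (coeff q 0)) + const (coeff q 0) * (p - const (coeff p 0))"
      by (simp add: const_mult algebra_simps)
    then show ?case
      using ideal_poly_ringD(3)[OF id(1) ideal_poly_ringD(4)[OF id(1) mult(1,4)]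
        ideal_poly_ringD(4)[OF id(1) _ mult(3)]] by simp
  qed
  then show "{p \<in> carrier (poly_ring V). coeff (p :: 'k mpoly) 0 = 0} \<subseteq> irrelevant_ideal V"
    by fastforce
qed

lemma ideal_irrelevant_ideal: "ideal (irrelevant_ideal V :: 'k::field mpoly set) (poly_ring V)"
  unfolding irrelevant_ideal_def by (rule genideal_poly_ring) auto

section \<open>Linear parts and the space they span\<close>

lemma pp_degree_eq_1: "pp_degree t = 1 \<longleftrightarrow> (\<exists>i. t = indet_pp i)"
proof
  assume *: "pp_degree t = 1"
  then obtain i where i: "i \<in> Poly_Mapping.keys t" "coeff t i = 1" "\<forall>j\<in>Poly_Mapping.keys t. j \<noteq> i \<longrightarrow> coeff t j = 0"
    unfolding pp_degree_def by (auto simp: sum_eq_Suc0_iff)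
  have "t = indet_pp i"
    by (rule poly_mapping_eqI) (use i in \<open>auto simp: indet_pp_def lookup_single when_def in_keys_iff\<close>)
  then show "\<exists>i. t = indet_pp i" ..
qed (auto simp: pp_degree_def indet_pp_def)

lemma coeff_linear_part: "coeff (linear_part p) t = (if \<exists>i. t = indet_pp i then coeff p t else 0)"
proof -
  have "coeff (linear_part p) t = (\<Sum>s\<in>{s \<in> keys p. pp_degree s = 1}. if s = t then coeff p t else 0)"
    unfolding linear_part_def hom_component_def lookup_sum
    by (rule sum.cong) (auto simp: lookup_single when_def)
  also have "\<dots> = (if t \<in> {s \<in> keys p. pp_degree s = 1} then coeff p t else 0)"
    by (subst sum.delta) auto
  also have "\<dots> = (if \<exists>i. t = indet_pp i then coeff p t else 0)"
    unfolding pp_degree_eq_1 by (auto simp: in_keys_iff)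
  finally show ?thesis .
qed

lemma linear_part_add: "linear_part (p + q) = linear_part p + linear_part q"
  by (rule poly_mapping_eqI) (auto simp: coeff_linear_part lookup_add)

lemma linear_part_diff: "linear_part (p - q) = linear_part p - linear_part q"
  by (rule poly_mapping_eqI) (auto simp: coeff_linear_part lookup_minus)

lemma linear_part_mult:
  "linear_part (p * q) = scale (coeff p 0) (linear_part q) + scale (coeff q 0) (linear_part p)"
  by (rule poly_mapping_eqI) (auto simp: coeff_linear_part lookup_add scale_def coeff_mult_indet_pp)

lemma linear_part_scale: "linear_part (scale c p) = scale c (linear_part p)"
  by (rule poly_mapping_eqI) (auto simp: coeff_linear_part scale_def)

lemma linear_part_const [simp]: "linear_part (const c) = 0"
  by (rule poly_mapping_eqI) (auto simp: coeff_linear_part coeff_const)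

lemma linear_part_0 [simp]: "linear_part 0 = 0"
  by (rule poly_mapping_eqI) (auto simp: coeff_linear_part)

lemma linear_part_indet [simp]: "linear_part (indet i) = indet i"
  by (rule poly_mapping_eqI) (auto simp: coeff_linear_part coeff_indet)

text \<open>An ideal is closed under sums and scalar multiples and \<open>linear_part\<close> is
  linear, so the linear parts already form a subspace. Hence every element of the span lifts to a
  single element of \<open>J\<close>.\<close>

lemma linear_part_space_eq:
  fixes J :: "'k::field mpoly set"
  assumes "ideal J (poly_ring V)"
  shows "linear_part_space J = linear_part ` J"
proof -
  have "mpoly.subspace (linear_part ` J)"
  proof (rule mpoly.subspaceI)
    show "0 \<in> linear_part ` J"
      by (rule image_eqI[of _ _ 0]) (auto simp: ideal_poly_ringD[OF assms])
    fix x y assume "x \<in> linear_part ` J" "y \<in> linear_part ` J"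
    then show "x + y \<in> linear_part ` J"
      using ideal_poly_ringD(3)[OF assms] by (auto simp flip: linear_part_add)
  next
    fix c x assume "x \<in> linear_part ` J"
    then obtain p where "p \<in> J" "x = linear_part p" by blast
    moreover from this have "scale c p \<in> J"
      by (simp add: ideal_poly_ringD(4)[OF assms] scale_def)
    ultimately have "scale c p \<in> J" "scale c x = linear_part (scale c p)"
      by (simp_all add: linear_part_scale)
    then show "scale c x \<in> linear_part ` J" by simp
  qed
  then show ?thesis
    unfolding linear_part_space_def by (rule mpoly.span_eq_iff[THEN iffD2])
qed

lemma linear_part_in_span_indets:
  fixes p :: "'k::field mpoly"
  assumes "p \<in> carrier (poly_ring V)"
  shows "linear_part p \<in> mpoly.span (indet ` V)"
  using assms
  by (induction rule: poly_ring_induct)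
    (auto simp: linear_part_add linear_part_mult mpoly.span_zero mpoly.span_base
      intro!: mpoly.span_add mpoly.span_scale)

lemma independent_indets: "mpoly.independent (indet ` V :: 'k::field mpoly set)"
proof -
  have "a \<notin> mpoly.span (indet ` V - {a})" if "a \<in> indet ` V" for a :: "'k mpoly"
  proof -
    from that obtain i where i: "a = indet i" by blast
    \<comment> \<open>The functional reading off the coefficient of \<open>indet_pp i\<close> kills
      all other indeterminates, but not \<open>indet i\<close>.\<close>
    have "mpoly.subspace {p :: 'k mpoly. coeff p (indet_pp i) = 0}"
      by (rule mpoly.subspaceI) (auto simp: lookup_add scale_def)
    moreover have "indet ` V - {a} \<subseteq> {p. coeff p (indet_pp i) = 0}"
      using i by (auto simp: coeff_indet)
    ultimately have "mpoly.span (indet ` V - {a}) \<subseteq> {p. coeff p (indet_pp i) = 0}"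
      by (rule mpoly.span_minimal[rotated])
    then show ?thesis using i by (auto simp: coeff_indet)
  qed
  then show ?thesis unfolding mpoly.dependent_def by blast
qed

lemma inj_indet: "inj (indet :: nat \<Rightarrow> 'k::field mpoly)"
proof (rule injI)
  fix i j assume "indet i = (indet j :: 'k mpoly)"
  then have "coeff (indet i :: 'k mpoly) (indet_pp i) = coeff (indet j) (indet_pp i)" by simp
  then show "i = j" by (auto simp: coeff_indet split: if_splits)
qed

section \<open>The cotangent space\<close>

text \<open>Stated for an arbitrary ring, so that it applies to \<open>max_ideal_square V J\<close>
  inside \<open>poly_ring V Quot J\<close> without computing with cosets of cosets.\<close>

lemma (in ideal) coset_add_eq_iff:
  assumes "a \<in> carrier R" "b \<in> carrier R"
  shows "I +> (a \<oplus> b) = I +> b \<longleftrightarrow> a \<in> I"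
proof -
  interpret Q: ring "R Quot I" by (rule quotient_is_ring)
  note hom = rcos_ring_hom
  have "I +> (a \<oplus> b) = (I +> a) \<oplus>\<^bsub>R Quot I\<^esub> (I +> b)"
    using ring_hom_add[OF hom assms] .
  moreover have "I +> a \<in> carrier (R Quot I)" "I +> b \<in> carrier (R Quot I)"
    using ring_hom_closed[OF hom] assms by auto
  ultimately have "I +> (a \<oplus> b) = I +> b \<longleftrightarrow> I +> a = \<zero>\<^bsub>R Quot I\<^esub>"
    by (metis Q.l_zero Q.add.right_cancel Q.zero_closed)
  also have "\<dots> \<longleftrightarrow> a \<in> I"
    using a_rcos_const a_rcos_self[OF assms(1)] by (auto simp: FactRing_def)
  finally show ?thesis .
qed

lemma pp_nonzero_cases:
  assumes "t \<in> pps V" "t \<noteq> 0"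
  obtains i s where "i \<in> V" "s \<in> pps V" "t = indet_pp i + s"
proof -
  have "t = 0 \<or> (\<exists>i\<in>V. \<exists>s\<in>pps V. t = indet_pp i + s)"
    using assms(1) by (induction rule: pp_induct) auto
  then show ?thesis using assms(2) that by blast
qed

context
  fixes V :: "nat set" and J :: "'k::field mpoly set"
  assumes J: "ideal J (poly_ring V)" and J_sub: "J \<subseteq> irrelevant_ideal V"
begin

abbreviation (input) "cl \<equiv> (\<lambda>p. J +>\<^bsub>poly_ring V\<^esub> p)"

lemma ring_quot: "ring (poly_ring V Quot J)"
  by (rule ideal.quotient_is_ring[OF J])

lemma ideal_max_ideal_image: "ideal (max_ideal_image V J) (poly_ring V Quot J)"
  unfolding max_ideal_image_def
  by (rule ring.ring_ideal_imp_quot_ideal[OF ring_poly_ring J ideal_irrelevant_ideal])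

lemma ideal_max_ideal_square: "ideal (max_ideal_square V J) (poly_ring V Quot J)"
  unfolding max_ideal_square_def
  by (rule ring.ideal_prod_is_ideal[OF ring_quot ideal_max_ideal_image ideal_max_ideal_image])

text \<open>By the Leibniz rule, a product of two polynomials without constant term has no linear
  part, and sums preserve this.\<close>

lemma max_ideal_square_imp:
  assumes "A \<in> max_ideal_square V J"
  shows "\<exists>q. A = cl q \<and> q \<in> irrelevant_ideal V \<and> linear_part q = 0"
  using assms unfolding max_ideal_square_def
proof (induction rule: ideal_prod.induct)
  case (prod A B)
  then obtain a b where ab: "A = cl a" "B = cl b" "a \<in> irrelevant_ideal V" "b \<in> irrelevant_ideal V"
    by (auto simp: max_ideal_image_def)
  then show ?case
    by (intro exI[of _ "a * b"])
      (auto simp: irrelevant_ideal_eq quot_poly_ring_ops[OF J] linear_part_mult scale_def)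
next
  case (sum A B)
  then obtain a b where ab: "A = cl a" "B = cl b" "a \<in> irrelevant_ideal V" "b \<in> irrelevant_ideal V"
      "linear_part a = 0" "linear_part b = 0"
    by auto
  then show ?case
    by (intro exI[of _ "a + b"])
      (auto simp: irrelevant_ideal_eq quot_poly_ring_ops[OF J] linear_part_add lookup_add)
qed

text \<open>Every term of \<open>p\<close> has degree at least 2, hence is an indeterminate times a
  non-constant term, a product of two elements of the irrelevant ideal.\<close>

lemma max_ideal_square_if:
  assumes p: "p \<in> irrelevant_ideal V" "linear_part p = 0"
  shows "cl p \<in> max_ideal_square V J"
proof -
  have terms: "cl (const c * pp_poly t) \<in> max_ideal_square V J" if t: "t \<in> keys p" for t c
  proof -
    have "t \<in> pps V" "t \<noteq> 0"
      using p(1) t by (auto simp: irrelevant_ideal_eq carrier_poly_ring in_keys_iff)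
    then obtain i s where ts: "i \<in> V" "s \<in> pps V" "t = indet_pp i + s"
      by (rule pp_nonzero_cases)
    have "s \<noteq> 0"
    proof
      assume "s = 0"
      then have "coeff p t = coeff (linear_part p) t"
        using ts by (auto simp: coeff_linear_part)
      then show False using p(2) t by (simp add: in_keys_iff)
    qed
    then have "const c * pp_poly s \<in> irrelevant_ideal V" "indet i \<in> (irrelevant_ideal V :: 'k mpoly set)"
      using ts by (auto simp: irrelevant_ideal_eq coeff_pp_poly coeff_indet)
    moreover from this have "cl (const c * pp_poly t) = cl (indet i) \<otimes>\<^bsub>poly_ring V Quot J\<^esub> cl (const c * pp_poly s)"
      by (subst quot_poly_ring_ops[OF J])
        (auto simp: irrelevant_ideal_eq ts pp_poly_add indet_def algebra_simps)
    ultimately show ?thesis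
      unfolding max_ideal_square_def max_ideal_image_def by (auto intro: ideal_prod.prod)
  qed
  have pps: "t \<in> pps V" if "t \<in> keys p" for t
    using p(1) that by (auto simp: irrelevant_ideal_eq carrier_poly_ring)
  have zero: "cl 0 \<in> max_ideal_square V J"
    using additive_subgroup.zero_closed[OF ideal.axioms(1)[OF ideal_max_ideal_square]]
    by (simp add: FactRing_def coset_poly_ring)
  have "cl (\<Sum>t\<in>A. const (coeff p t) * pp_poly t) \<in> max_ideal_square V J"
    if "A \<subseteq> keys p" for A
    using finite_subset[OF that finite_keys] that
  proof (induction A rule: finite_induct)
    case (insert t A)
    have carr: "\<And>s. s \<in> insert t A \<Longrightarrow> const (coeff p s) * pp_poly s \<in> carrier (poly_ring V)"
      using insert pps by auto
    have "cl (const (coeff p t) * pp_poly t) \<oplus>\<^bsub>poly_ring V Quot J\<^esub> cl (\<Sum>t\<in>A. const (coeff p t) * pp_poly t)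
        \<in> max_ideal_square V J"
      using insert terms unfolding max_ideal_square_def by (intro ideal_prod.sum) auto
    then show ?case using insert.hyps carr
      by (subst (asm) quot_poly_ring_ops[OF J]) (auto intro!: sum_in_carrier)
  qed (use zero in auto)
  from this[of "keys p"] show ?thesis by (simp flip: poly_expansion)
qed

text \<open>The square of the maximal ideal of P/J is the image of the polynomials without constant
  and linear part. So membership of a class means that the linear part of \<open>p\<close> can be
  cancelled by an element of \<open>J\<close>.\<close>

lemma in_max_ideal_square_iff:
  assumes p: "p \<in> irrelevant_ideal V"
  shows "cl p \<in> max_ideal_square V J \<longleftrightarrow> linear_part p \<in> linear_part_space J"
proof
  assume "cl p \<in> max_ideal_square V J"
  then obtain q where "cl p = cl q" "linear_part q = 0"
    using max_ideal_square_imp by blast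
  then show "linear_part p \<in> linear_part_space J"
    unfolding coset_eq_iff[OF J] linear_part_space_eq[OF J]
    by (intro image_eqI[of _ _ "p - q"]) (auto simp: linear_part_diff)
next
  assume "linear_part p \<in> linear_part_space J"
  then obtain f where f: "f \<in> J" "linear_part p = linear_part f"
    unfolding linear_part_space_eq[OF J] by blast
  have "cl (p - f) \<in> max_ideal_square V J"
    using f J_sub p ideal_poly_ringD(6)[OF ideal_irrelevant_ideal]
    by (intro max_ideal_square_if) (auto simp: linear_part_diff)
  also have "cl (p - f) = cl p"
    using f ideal_poly_ringD(5)[OF J] by (simp add: coset_eq_iff[OF J])
  finally show "cl p \<in> max_ideal_square V J" .
qed

text \<open>This identifies the cotangent space with linear forms modulo
  \<open>linear_part_space J\<close>; from here on, cotangent notions become linear algebra of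
  linear forms.\<close>

lemma mod_square_class_eq_iff:
  assumes "p \<in> irrelevant_ideal V" "q \<in> irrelevant_ideal V"
  shows "mod_square_class V J p = mod_square_class V J q \<longleftrightarrow> linear_part p - linear_part q \<in> linear_part_space J"
proof -
  have carr: "p - q \<in> carrier (poly_ring V)" "q \<in> carrier (poly_ring V)"
    using assms by (auto simp: irrelevant_ideal_eq)
  have "cl p = cl (p - q) \<oplus>\<^bsub>poly_ring V Quot J\<^esub> cl q"
    by (simp add: quot_poly_ring_ops[OF J carr])
  then have "mod_square_class V J p = mod_square_class V J q \<longleftrightarrow> cl (p - q) \<in> max_ideal_square V J"
    unfolding mod_square_class_def
    using ideal.coset_add_eq_iff[OF ideal_max_ideal_square, of "cl (p - q)" "cl q"] carr
    by (simp add: carrier_quot_poly_ring)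
  then show ?thesis
    using in_max_ideal_square_iff[OF ideal_poly_ringD(6)[OF ideal_irrelevant_ideal assms]]
    by (simp add: linear_part_diff)
qed

lemma mod_square_class_eq_zero_iff:
  assumes "p \<in> irrelevant_ideal V"
  shows "mod_square_class V J p = \<zero>\<^bsub>mod_square_ring V J\<^esub> \<longleftrightarrow> linear_part p \<in> linear_part_space J"
proof -
  have "mod_square_class V J 0 = \<zero>\<^bsub>mod_square_ring V J\<^esub>"
  proof -
    have "cl 0 = \<zero>\<^bsub>poly_ring V Quot J\<^esub>"
      by (simp add: FactRing_def coset_poly_ring)
    then show ?thesis
      unfolding mod_square_class_def mod_square_ring_def
      using ring_hom_zero[OF ideal.rcos_ring_hom[OF ideal_max_ideal_square] ring_quot
          ideal.quotient_is_ring[OF ideal_max_ideal_square]] by simp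
  qed
  then show ?thesis
    using mod_square_class_eq_iff[OF assms, of 0] by (simp add: irrelevant_ideal_eq)
qed

lemma mod_square_class_mult:
  assumes "p \<in> carrier (poly_ring V)" "q \<in> carrier (poly_ring V)"
  shows "mod_square_class V J p \<otimes>\<^bsub>mod_square_ring V J\<^esub> mod_square_class V J q = mod_square_class V J (p * q)"
  using ring_hom_mult[OF ideal.rcos_ring_hom[OF ideal_max_ideal_square], of "cl p" "cl q"] assms
  by (simp add: mod_square_class_def mod_square_ring_def carrier_quot_poly_ring quot_poly_ring_ops[OF J])

lemma trivial_indets_iff:
  "i \<in> trivial_indets V J \<longleftrightarrow> i \<in> V \<and> indet i \<in> linear_part_space J"
  using mod_square_class_eq_zero_iff[of "indet i"]
  by (auto simp: trivial_indets_def irrelevant_ideal_eq coeff_indet)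

lemma linear_part_space_diff:
  "p \<in> linear_part_space J \<Longrightarrow> q \<in> linear_part_space J \<Longrightarrow> p - q \<in> linear_part_space J"
  "p \<in> linear_part_space J \<Longrightarrow> scale c p \<in> linear_part_space J"
  unfolding linear_part_space_def by (simp_all add: mpoly.span_diff mpoly.span_scale)

lemma cotangent_line_eq:
  assumes "i \<in> V"
  shows "cotangent_line V J i = {mod_square_class V J (scale c (indet i)) | c. True}"
  using assms by (simp add: cotangent_line_def mod_square_class_mult scale_def)

lemma scale_indet_irrelevant: "i \<in> V \<Longrightarrow> scale c (indet i) \<in> (irrelevant_ideal V :: 'k mpoly set)"
  by (simp add: irrelevant_ideal_eq scale_def coeff_indet)

text \<open>A line lies in another one as soon as its generator does; the multiples then follow by
  scaling the relation.\<close>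

lemma cotangent_line_subset_iff:
  assumes "i \<in> V" "j \<in> V"
  shows "cotangent_line V J i \<subseteq> cotangent_line V J j \<longleftrightarrow> (\<exists>c. indet i - scale c (indet j) \<in> linear_part_space J)"
proof -
  have eq: "mod_square_class V J (scale c (indet i)) = mod_square_class V J (scale d (indet j)) \<longleftrightarrow>
      scale c (indet i) - scale d (indet j) \<in> linear_part_space J" for c d
    using mod_square_class_eq_iff[OF scale_indet_irrelevant scale_indet_irrelevant, OF assms]
    by (simp add: linear_part_scale)
  show ?thesis
  proof
    assume "cotangent_line V J i \<subseteq> cotangent_line V J j"
    then have "mod_square_class V J (scale 1 (indet i)) \<in> cotangent_line V J j"
      unfolding cotangent_line_eq[OF assms(1)] by blast
    then show "\<exists>c. indet i - scale c (indet j) \<in> linear_part_space J"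
      unfolding cotangent_line_eq[OF assms(2)] by (auto simp: eq simp del: mpoly.scale_one) auto
  next
    assume "\<exists>c. indet i - scale c (indet j) \<in> linear_part_space J"
    then obtain c where c: "indet i - scale c (indet j) \<in> linear_part_space J" by blast
    have "scale d (indet i) - scale (d * c) (indet j) \<in> linear_part_space J" for d
      using linear_part_space_diff(2)[OF c, of d] by (simp add: mpoly.scale_right_diff_distrib)
    then show "cotangent_line V J i \<subseteq> cotangent_line V J j"
      unfolding cotangent_line_eq[OF assms(1)] cotangent_line_eq[OF assms(2)]
      using eq by blast
  qed
qed

lemma cotangent_equiv_iff:
  "(i, j) \<in> cotangent_equiv V J \<longleftrightarrow> i \<in> V \<and> j \<in> V \<and>
    (\<exists>c. indet i - scale c (indet j) \<in> linear_part_space J) \<and>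
    (\<exists>c. indet j - scale c (indet i) \<in> linear_part_space J)"
  using cotangent_line_subset_iff[of i j] cotangent_line_subset_iff[of j i]
  by (auto simp: cotangent_equiv_def)

text \<open>The scalar \<open>c\<close> cannot vanish, as \<open>i\<close> would be trivial
  otherwise; dividing by it gives the converse relation.\<close>

lemma nontrivial_cotangent_equivI:
  assumes "i \<in> V" "j \<in> V" "indet i \<notin> linear_part_space J"
    and c: "indet i - scale c (indet j) \<in> linear_part_space J"
  shows "(i, j) \<in> cotangent_equiv V J"
proof -
  have "c \<noteq> 0" using assms(3,4) by auto
  then have "indet j - scale (1 / c) (indet i) \<in> linear_part_space J"
    using linear_part_space_diff(2)[OF c, of "- (1 / c)"]
    by (simp add: mpoly.scale_right_diff_distrib)
  then show ?thesis using assms unfolding cotangent_equiv_iff by blast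
qed

end

section \<open>Term orderings and reduced Groebner bases\<close>

lemma coeff_pp_poly_mult [simp]:
  "coeff (pp_poly u * f) (u + s) = coeff (f :: 'k::field mpoly) s"
proof -
  have "coeff (pp_poly u * f) (u + s) = (\<Sum>l. (\<Sum>q. coeff f q when s = q) when l = u)"
    unfolding lookup_mult by (rule Sum_any.cong) (auto simp: coeff_pp_poly when_def)
  then show ?thesis by simp
qed

lemma keys_pp_poly [simp]: "keys (pp_poly t :: 'k::field mpoly) = {t}"
  by (simp add: pp_poly_def)

lemma keys_pp_poly_mult: "keys (pp_poly u * (f :: 'k::field mpoly)) = (\<lambda>s. u + s) ` keys f"
proof
  show "keys (pp_poly u * f) \<subseteq> (\<lambda>s. u + s) ` keys f"
    using keys_mult[of "pp_poly u" f] by (auto simp: pp_poly_def)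
  show "(\<lambda>s. u + s) ` keys f \<subseteq> keys (pp_poly u * f)"
    by (auto simp: in_keys_iff)
qed

section \<open>Divisibility of terms: Dickson's lemma and minimal terms\<close>

lemma pps_addD: "s + u \<in> pps V \<Longrightarrow> s \<in> pps V \<and> u \<in> pps V"
  by (auto simp: pps_def in_keys_iff lookup_add subset_iff)

text \<open>There is a monotone subsequence. If it is decreasing, it is constant from the place
  where it attains its minimum, and that tail is increasing.\<close>

lemma nat_seq_incseq_subseq:
  fixes s :: "nat \<Rightarrow> nat"
  shows "\<exists>f. strict_mono f \<and> incseq (\<lambda>n. s (f n))"
proof -
  obtain f where f: "strict_mono f" "monoseq (\<lambda>n. s (f n))"
    using seq_monosub by blast
  show ?thesis
  proof (cases "incseq (\<lambda>n. s (f n))")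
    case False
    then have dec: "decseq (\<lambda>n. s (f n))"
      using f(2) by (simp add: monoseq_iff)
    obtain N where N: "\<And>n. s (f N) \<le> s (f n)"
      using ex_has_least_nat[of "\<lambda>_. True" 0 "\<lambda>n. s (f n)"] by auto
    have "s (f (N + n)) = s (f N)" for n
      using N[of "N + n"] decseqD[OF dec, of N "N + n"] by simp
    then have "incseq (\<lambda>n. s (f (N + n)))" by (simp add: incseq_def)
    moreover have "strict_mono (\<lambda>n. f (N + n))"
      using f(1) by (simp add: strict_mono_def)
    ultimately show ?thesis by blast
  qed (use f in blast)
qed

text \<open>Dickson's lemma. Passing to a subsequence once for each indeterminate makes all
  exponents weakly increasing; then the first term of the subsequence divides the second.\<close>

lemma dickson:
  fixes t :: "nat \<Rightarrow> pp"
  assumes "finite V" "\<And>n. t n \<in> pps V"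
  obtains i j s where "i < j" "t j = t i + s"
proof -
  have "\<exists>f. strict_mono f \<and> (\<forall>x\<in>V. incseq (\<lambda>n. coeff (t (f n)) x))"
    using assms(1)
  proof (induction V rule: finite_induct)
    case empty
    then show ?case by (auto intro: exI[of _ id] strict_monoI)
  next
    case (insert x V)
    then obtain f where f: "strict_mono f" "\<And>y. y \<in> V \<Longrightarrow> incseq (\<lambda>n. coeff (t (f n)) y)"
      by blast
    obtain g where g: "strict_mono g" "incseq (\<lambda>n. coeff (t (f (g n))) x)"
      using nat_seq_incseq_subseq[of "\<lambda>n. coeff (t (f n)) x"] by blast
    have "incseq (\<lambda>n. coeff (t (f (g n))) y)" if "y \<in> V" for y
      using f(2)[OF that] strict_mono_less_eq[OF g(1)] by (simp add: incseq_def)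
    moreover have "strict_mono (\<lambda>n. f (g n))"
      using f(1) g(1) by (simp add: strict_mono_def)
    ultimately show ?case using g(2) by (intro exI[of _ "\<lambda>n. f (g n)"]) auto
  qed
  then obtain f where f: "strict_mono f" "\<And>x. x \<in> V \<Longrightarrow> incseq (\<lambda>n. coeff (t (f n)) x)"
    by blast
  have "coeff (t (f 0)) x \<le> coeff (t (f 1)) x" for x
  proof (cases "x \<in> V")
    case True
    then show ?thesis using f(2) by (simp add: incseq_def)
  next
    case False
    then have "coeff (t (f 0)) x = 0"
      using assms(2)[of "f 0"] by (auto simp: pps_def in_keys_iff subset_iff)
    then show ?thesis by simp
  qed
  then have "t (f 1) = t (f 0) + (t (f 1) - t (f 0))"
    by (intro poly_mapping_eqI) (simp add: lookup_add lookup_minus)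
  moreover have "f 0 < f 1" using f(1) by (simp add: strict_mono_def)
  ultimately show ?thesis using that by blast
qed

text \<open>Minimality refers to divisibility, not to a term ordering. Applied to the leading terms
  of an ideal, it gives the minimal generators of the leading term ideal.\<close>

definition minimal_pps :: "pp set \<Rightarrow> pp set" where
  "minimal_pps T = {m \<in> T. \<forall>s\<in>T. \<forall>u. m = s + u \<longrightarrow> s = m}"

text \<open>An infinite set of minimal terms would contain an injective sequence, in which Dickson's
  lemma finds one term dividing a different one.\<close>

lemma finite_minimal_pps:
  assumes "finite V" "T \<subseteq> pps V"
  shows "finite (minimal_pps T)"
proof (rule ccontr)
  assume "infinite (minimal_pps T)"
  then obtain t :: "nat \<Rightarrow> pp" where t: "inj t" "range t \<subseteq> minimal_pps T"
    using infinite_countable_subset by blast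
  have "t n \<in> pps V" for n
    using t(2) assms(2) by (auto simp: minimal_pps_def)
  then obtain i j s where "i < j" "t j = t i + s"
    using dickson[OF assms(1)] by blast
  moreover have "t i \<in> T" "t j \<in> minimal_pps T" using t(2) by (auto simp: minimal_pps_def)
  ultimately have "t i = t j" by (auto simp: minimal_pps_def)
  then show False using injD[OF t(1)] \<open>i < j\<close> by auto
qed

text \<open>The polynomials supported on multiples of elements of \<open>M\<close> form an ideal
  containing the generators, so they contain the generated ideal.\<close>

lemma monomial_ideal_membership:
  assumes "M \<subseteq> pps V" and "pp_poly t \<in> Idl\<^bsub>poly_ring V\<^esub> (pp_poly ` M :: 'k::field mpoly set)"
  shows "\<exists>m\<in>M. \<exists>u. t = m + u"
proof -
  define D where "D = {m + u | m u. m \<in> M}"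
  have D_add: "a + s \<in> D" if s: "s \<in> D" for a s
  proof -
    obtain m u where "m \<in> M" "s = m + u" using s unfolding D_def by blast
    then have "a + s = m + (a + u)" "m \<in> M" by (simp_all add: add.left_commute)
    then show ?thesis unfolding D_def by blast
  qed
  have M_D: "m \<in> D" if "m \<in> M" for m
    unfolding D_def by (intro CollectI exI[of _ m] exI[of _ 0]) (simp add: that)
  let ?J = "{p \<in> carrier (poly_ring V). keys (p :: 'k mpoly) \<subseteq> D}"
  have "ideal ?J (poly_ring V)"
  proof (rule ideal_poly_ringI)
    show "p + q \<in> ?J" if "p \<in> ?J" "q \<in> ?J" for p q
      using that keys_add[of p q] by auto
    show "p * q \<in> ?J" if "p \<in> carrier (poly_ring V)" "q \<in> ?J" for p q
      using that keys_mult[of p q] D_add by fastforce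
  qed auto
  moreover have "pp_poly ` M \<subseteq> ?J"
    using M_D assms(1) by (auto simp: pp_poly_def carrier_poly_ring)
  ultimately have "pp_poly t \<in> ?J"
    using genideal_poly_ring_minimal assms(2) by blast
  then have "t \<in> D" by (simp add: pp_poly_def)
  then show ?thesis unfolding D_def by blast
qed

definition leading_pps :: "(pp \<times> pp) set \<Rightarrow> 'k::field mpoly set \<Rightarrow> pp set" where
  "leading_pps \<sigma> J = LT \<sigma> ` (J - {0})"

section \<open>Well-foundedness of term orderings, and leading terms\<close>

context
  fixes V :: "nat set" and \<sigma> :: "(pp \<times> pp) set"
  assumes \<sigma>: "term_ordering V \<sigma>" and fin: "finite V"
begin

lemma linear_term_ordering: "linear_order_on (pps V) \<sigma>"
  using \<sigma> by (simp add: term_ordering_def)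

lemma term_ordering_sub: "(s, t) \<in> \<sigma> \<Longrightarrow> s \<in> pps V \<and> t \<in> pps V"
  using linear_term_ordering unfolding order_on_defs by blast

lemma term_ordering_refl: "s \<in> pps V \<Longrightarrow> (s, s) \<in> \<sigma>"
  using linear_term_ordering refl_onD[of "pps V" \<sigma> s] by (simp add: order_on_defs)

lemma term_ordering_antisym: "(s, t) \<in> \<sigma> \<Longrightarrow> (t, s) \<in> \<sigma> \<Longrightarrow> s = t"
  using linear_term_ordering antisymD[of \<sigma> s t] by (simp add: order_on_defs)

lemma term_ordering_trans: "(s, t) \<in> \<sigma> \<Longrightarrow> (t, u) \<in> \<sigma> \<Longrightarrow> (s, u) \<in> \<sigma>"
  using linear_term_ordering transD[of \<sigma> s t u] by (simp add: order_on_defs)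

lemma term_ordering_total: "s \<in> pps V \<Longrightarrow> t \<in> pps V \<Longrightarrow> (s, t) \<in> \<sigma> \<or> (t, s) \<in> \<sigma>"
  using linear_term_ordering term_ordering_refl[of s]
  by (cases "s = t") (auto simp: order_on_defs total_on_def)

lemma term_ordering_add: "(s, t) \<in> \<sigma> \<Longrightarrow> u \<in> pps V \<Longrightarrow> (s + u, t + u) \<in> \<sigma>"
  using \<sigma> unfolding term_ordering_def by blast

lemma term_ordering_divides:
  assumes "s \<in> pps V" "u \<in> pps V"
  shows "(s, s + u) \<in> \<sigma>"
proof -
  have "(0, u) \<in> \<sigma>" using \<sigma> assms(2) unfolding term_ordering_def by blast
  from term_ordering_add[OF this assms(1)] show ?thesis by (simp add: add.commute[of s])
qed

text \<open>In a strictly descending chain, Dickson's lemma yields a later term that is a multiple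
  of an earlier one, hence not smaller, a contradiction.\<close>

lemma wf_term_ordering: "wf (\<sigma> - Id)"
  unfolding wf_iff_no_infinite_down_chain
proof
  assume "\<exists>t. \<forall>i. (t (Suc i), t i) \<in> \<sigma> - Id"
  then obtain t where t: "\<And>i. (t (Suc i), t i) \<in> \<sigma> - Id" by blast
  have pps: "t i \<in> pps V" for i using t[of i] term_ordering_sub by blast
  have chain: "(t (Suc (i + k)), t i) \<in> \<sigma> - Id" for i k
  proof (induction k)
    case (Suc k)
    have "(t (Suc (i + Suc k)), t (Suc (i + k))) \<in> \<sigma> - Id" using t[of "Suc (i + k)"] by simp
    then show ?case using Suc.IH by (auto dest: term_ordering_trans term_ordering_antisym)
  qed (use t in simp)
  obtain i j s where ij: "i < j" "t j = t i + s"
    using dickson[OF fin, of t] pps by blast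
  moreover have "s \<in> pps V" using pps[of j] pps_addD ij(2) by metis
  ultimately have "(t i, t j) \<in> \<sigma>" using term_ordering_divides[OF pps] by metis
  moreover obtain k where "j = Suc (i + k)" using ij(1) less_iff_Suc_add by auto
  ultimately show False using chain[of i k] term_ordering_antisym by blast
qed

lemma finite_pps_max:
  assumes "finite A" "A \<noteq> {}" "A \<subseteq> pps V"
  shows "\<exists>t\<in>A. \<forall>s\<in>A. (s, t) \<in> \<sigma>"
  using assms
proof (induction A rule: finite_ne_induct)
  case (singleton x)
  then show ?case using term_ordering_refl by simp
next
  case (insert x A)
  then obtain t where t: "t \<in> A" "\<forall>s\<in>A. (s, t) \<in> \<sigma>" by blast
  show ?case
  proof (cases "(x, t) \<in> \<sigma>")
    case False
    then have "(t, x) \<in> \<sigma>" using term_ordering_total[of t x] insert.prems t(1) by blast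
    then have "\<forall>s\<in>insert x A. (s, x) \<in> \<sigma>"
      using t term_ordering_trans term_ordering_refl insert.prems by blast
    then show ?thesis by blast
  qed (use t in blast)
qed

lemma LT_eqI:
  assumes "t \<in> keys p" "\<And>s. s \<in> keys p \<Longrightarrow> (s, t) \<in> \<sigma>"
  shows "LT \<sigma> p = t"
  unfolding LT_def
proof (rule the_equality)
  show "t' = t" if "t' \<in> keys p \<and> (\<forall>s\<in>keys p. (s, t') \<in> \<sigma>)" for t'
    using that assms term_ordering_antisym[of t' t] by blast
qed (use assms in blast)

lemma LT_props:
  fixes p :: "'k::field mpoly"
  assumes "p \<in> carrier (poly_ring V)" "p \<noteq> 0"
  shows "LT \<sigma> p \<in> keys p" "s \<in> keys p \<Longrightarrow> (s, LT \<sigma> p) \<in> \<sigma>"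
proof -
  obtain t where "t \<in> keys p" "\<forall>s\<in>keys p. (s, t) \<in> \<sigma>"
    using finite_pps_max[of "keys p"] assms
    by (auto simp: carrier_poly_ring keys_eq_empty)
  moreover from this have "LT \<sigma> p = t" using LT_eqI by blast
  ultimately show "LT \<sigma> p \<in> keys p" "s \<in> keys p \<Longrightarrow> (s, LT \<sigma> p) \<in> \<sigma>" by auto
qed

text \<open>Take the \<sigma>-least divisor of \<open>t\<close> in \<open>T\<close>: a proper
  divisor of it in \<open>T\<close> would again divide \<open>t\<close> and be
  \<sigma>-smaller.\<close>

lemma minimal_pps_divides:
  assumes "T \<subseteq> pps V" "t \<in> T"
  shows "\<exists>m\<in>minimal_pps T. \<exists>u. t = m + u"
proof -
  define D where "D = {s \<in> T. \<exists>u. t = s + u}"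
  have "\<exists>u. t = t + u" by (rule exI[of _ 0]) simp
  then have "t \<in> D" using assms(2) by (simp add: D_def)
  then obtain m where m: "m \<in> D" "\<And>s. (s, m) \<in> \<sigma> - Id \<Longrightarrow> s \<notin> D"
    using wfE_min[OF wf_term_ordering] by metis
  obtain v where v: "t = m + v" using m(1) unfolding D_def by blast
  have "s = m" if s: "s \<in> T" "m = s + u" for s u
  proof (rule ccontr)
    assume "s \<noteq> m"
    have "m \<in> pps V" using m(1) assms(1) by (auto simp: D_def)
    then have "s \<in> pps V" "u \<in> pps V" using pps_addD[of s u V] by (simp_all add: s(2))
    then have "(s, m) \<in> \<sigma> - Id" using term_ordering_divides[of s u] \<open>s \<noteq> m\<close> by (simp add: s(2))
    moreover have "t = s + (u + v)" by (simp add: v s(2) add.assoc)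
    then have "s \<in> D" using s(1) unfolding D_def by blast
    ultimately show False using m(2) by blast
  qed
  then have "m \<in> minimal_pps T" using m(1) unfolding minimal_pps_def D_def by blast
  then show ?thesis using v by blast
qed

section \<open>Normal forms and the reduced Groebner basis of an ideal\<close>

context
  fixes J :: "'k::field mpoly set"
  assumes J: "ideal J (poly_ring V)"
begin

lemma leading_pps_sub: "leading_pps \<sigma> J \<subseteq> pps V"
  using LT_props(1) ideal_poly_ringD(1)[OF J] by (fastforce simp: leading_pps_def carrier_poly_ring)

text \<open>Multiplication by \<open>u\<close> shifts the support of a polynomial and preserves the
  order, hence shifts the leading term.\<close>

lemma leading_pps_add:
  assumes "t \<in> leading_pps \<sigma> J" "u \<in> pps V"
  shows "t + u \<in> leading_pps \<sigma> J"
proof -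
  obtain f where f: "f \<in> J" "f \<noteq> 0" "t = LT \<sigma> f"
    using assms(1) by (auto simp: leading_pps_def)
  have carr: "f \<in> carrier (poly_ring V)" using f ideal_poly_ringD(1)[OF J] by blast
  note lt = LT_props[OF carr f(2)]
  have "LT \<sigma> (pp_poly u * f) = u + t"
  proof (rule LT_eqI)
    show "u + t \<in> keys (pp_poly u * f)"
      using lt(1) f(3) by (simp add: keys_pp_poly_mult)
    fix s assume "s \<in> keys (pp_poly u * f)"
    then obtain r where r: "r \<in> keys f" "s = u + r" by (auto simp: keys_pp_poly_mult)
    then have "(r + u, t + u) \<in> \<sigma>" using lt(2) f(3) term_ordering_add[OF _ assms(2)] by blast
    then show "(s, u + t) \<in> \<sigma>" by (simp add: r(2) add.commute)
  qed
  moreover have "pp_poly u * f \<in> J"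
    using f assms(2) ideal_poly_ringD(4)[OF J] by simp
  moreover have "pp_poly u * f \<noteq> 0"
    using lt(1) keys_pp_poly_mult[of u f] by force
  ultimately show ?thesis
    unfolding leading_pps_def by (intro image_eqI[of _ _ "pp_poly u * f"]) (simp_all add: add.commute)
qed

text \<open>Well-founded induction along \<sigma>: a leading term \<open>m\<close> of an element of
  \<open>J\<close> is congruent to a combination of smaller terms, which are replaced by their
  normal forms.\<close>

lemma normal_form_exists:
  assumes "m \<in> pps V"
  shows "\<exists>q\<in>carrier (poly_ring V). pp_poly m - q \<in> J \<and>
    (\<forall>s\<in>keys q. s \<notin> leading_pps \<sigma> J \<and> (s, m) \<in> \<sigma>)"
  using assms
proof (induction m rule: wf_induct_rule[OF wf_term_ordering])
  case (1 m)
  show ?case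
  proof (cases "m \<in> leading_pps \<sigma> J")
    case False
    then show ?thesis
      using "1.prems" ideal_poly_ringD(2)[OF J] term_ordering_refl
      by (intro bexI[of _ "pp_poly m"]) auto
  next
    case True
    then obtain f where f: "f \<in> J" "f \<noteq> 0" "m = LT \<sigma> f"
      by (auto simp: leading_pps_def)
    have carr: "f \<in> carrier (poly_ring V)" using f ideal_poly_ringD(1)[OF J] by blast
    note lt = LT_props[OF carr f(2), folded f(3)]
    define c where "c = coeff f m"
    have c: "c \<noteq> 0" using lt(1) by (simp add: c_def in_keys_iff)
    define A where "A = keys f - {m}"
    have "\<exists>q\<in>carrier (poly_ring V). pp_poly s - q \<in> J \<and>
        (\<forall>r\<in>keys q. r \<notin> leading_pps \<sigma> J \<and> (r, s) \<in> \<sigma>)" if "s \<in> A" for s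
      using that "1.IH"[of s] lt carr by (auto simp: A_def carrier_poly_ring)
    then obtain Q where Q: "\<And>s. s \<in> A \<Longrightarrow> Q s \<in> carrier (poly_ring V)"
        "\<And>s. s \<in> A \<Longrightarrow> pp_poly s - Q s \<in> J"
        "\<And>s r. s \<in> A \<Longrightarrow> r \<in> keys (Q s) \<Longrightarrow> r \<notin> leading_pps \<sigma> J \<and> (r, s) \<in> \<sigma>"
      by metis
    \<comment> \<open>Solving \<open>f\<close> for its leading term \<open>m\<close> gives the
      coefficients \<open>- coeff f s / c\<close>; each lower term \<open>s\<close> is then replaced
      by its normal form \<open>Q s\<close>.\<close>
    define q where "q = (\<Sum>s\<in>A. const (- coeff f s / c) * Q s)"
    have "f = const c * pp_poly m + (\<Sum>s\<in>A. const (coeff f s) * pp_poly s)"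
      unfolding A_def c_def using lt(1) by (subst poly_expansion[of f]) (simp add: sum.remove)
    then have "const (1 / c) * f = const (1 / c) * (const c * pp_poly m + (\<Sum>s\<in>A. const (coeff f s) * pp_poly s))"
      by (rule arg_cong)
    also have "\<dots> = pp_poly m + (\<Sum>s\<in>A. const (coeff f s / c) * pp_poly s)"
      using c by (simp add: distrib_left sum_distrib_left flip: mult.assoc const_mult)
    finally have eq: "pp_poly m - q = const (1 / c) * f + (\<Sum>s\<in>A. const (- coeff f s / c) * (pp_poly s - Q s))"
      unfolding q_def by (simp add: const_uminus right_diff_distrib sum_subtractf sum_negf)
    have "pp_poly m - q \<in> J"
      unfolding eq using f(1) Q(2)
      by (intro ideal_poly_ringD(3)[OF J] ideal_sum[OF J] ideal_poly_ringD(4)[OF J]) auto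
    moreover have "q \<in> carrier (poly_ring V)"
      unfolding q_def using Q(1) by (intro sum_in_carrier) auto
    moreover have "r \<notin> leading_pps \<sigma> J \<and> (r, m) \<in> \<sigma>" if r: "r \<in> keys q" for r
    proof -
      obtain s where s: "s \<in> A" "coeff (const (- coeff f s / c) * Q s) r \<noteq> 0"
        using r unfolding in_keys_iff q_def lookup_sum by (meson sum.not_neutral_contains_not_neutral)
      then have "r \<in> keys (Q s)" by (auto simp: in_keys_iff)
      with Q(3)[OF s(1)] have "r \<notin> leading_pps \<sigma> J" "(r, s) \<in> \<sigma>" by auto
      then show ?thesis using lt(2)[of s] s(1) term_ordering_trans by (auto simp: A_def)
    qed
    ultimately show ?thesis by blast
  qed
qed

text \<open>The basis consists of each minimal leading term minus its normal form. No term of a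
  normal form is a leading term of \<open>J\<close>, which gives both the leading terms of the basis
  elements and reducedness.\<close>

lemma reduced_groebner_basis_exists:
  "\<exists>N. (\<forall>m\<in>minimal_pps (leading_pps \<sigma> J). N m \<in> carrier (poly_ring V) \<and> keys (N m) \<inter> (leading_pps \<sigma> J) = {}) \<and>
    reduced_groebner_basis V \<sigma> J ((\<lambda>m. pp_poly m - N m) ` minimal_pps (leading_pps \<sigma> J))"
proof -
  define M where "M = minimal_pps (leading_pps \<sigma> J)"
  have M_sub: "M \<subseteq> leading_pps \<sigma> J" by (auto simp: M_def minimal_pps_def)
  obtain N where N: "\<And>m. m \<in> M \<Longrightarrow> N m \<in> carrier (poly_ring V)"
    "\<And>m. m \<in> M \<Longrightarrow> pp_poly m - N m \<in> J"
    "\<And>m s. m \<in> M \<Longrightarrow> s \<in> keys (N m) \<Longrightarrow> s \<notin> leading_pps \<sigma> J \<and> (s, m) \<in> \<sigma>"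
  proof -
    have "\<forall>m\<in>M. \<exists>q. q \<in> carrier (poly_ring V) \<and> pp_poly m - q \<in> J \<and>
        (\<forall>s\<in>keys q. s \<notin> leading_pps \<sigma> J \<and> (s, m) \<in> \<sigma>)"
      using normal_form_exists M_sub leading_pps_sub by blast
    from bchoice[OF this] show ?thesis using that by blast
  qed
  define g where "g m = pp_poly m - N m" for m
  have coeff_g: "coeff (g m) m = 1" if "m \<in> M" for m
  proof -
    have "m \<notin> keys (N m)" using N(3)[OF that] M_sub that by blast
    then show ?thesis by (simp add: g_def lookup_minus coeff_pp_poly in_keys_iff)
  qed
  have keys_g: "s = m \<or> s \<notin> leading_pps \<sigma> J \<and> (s, m) \<in> \<sigma>" if "m \<in> M" "s \<in> keys (g m)" for m s
  proof (cases "s = m")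
    case False
    then have "s \<in> keys (N m)"
      using that(2) by (simp add: g_def in_keys_iff lookup_minus coeff_pp_poly)
    then show ?thesis using N(3)[OF that(1)] by blast
  qed simp
  have LT_g: "LT \<sigma> (g m) = m" if "m \<in> M" for m
  proof (rule LT_eqI)
    show "m \<in> keys (g m)" using coeff_g[OF that] by (simp add: in_keys_iff)
    show "(s, m) \<in> \<sigma>" if "s \<in> keys (g m)" for s
      using keys_g[OF \<open>m \<in> M\<close> that] term_ordering_refl \<open>m \<in> M\<close> M_sub leading_pps_sub by blast
  qed
  have g_nz: "g m \<noteq> 0" if "m \<in> M" for m
    using coeff_g[OF that] by auto
  have LT_ideal_g: "LT_ideal V \<sigma> (g ` B) = Idl\<^bsub>poly_ring V\<^esub> (pp_poly ` B)" if "B \<subseteq> M" for B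
  proof -
    have nz: "g ` B - {0} = g ` B" using g_nz that by (auto simp: image_iff)
    have "(\<lambda>f. pp_poly (LT \<sigma> f)) ` (g ` B - {0}) = (\<lambda>m. pp_poly (LT \<sigma> (g m))) ` B"
      unfolding nz by (rule image_image)
    also have "\<dots> = (pp_poly ` B :: 'k mpoly set)"
      by (rule image_cong) (use LT_g that in auto)
    finally have "(\<lambda>f. pp_poly (LT \<sigma> f)) ` (g ` B - {0}) = (pp_poly ` B :: 'k mpoly set)" .
    then show ?thesis by (simp add: LT_ideal_def)
  qed
  have sub_carr: "pp_poly ` (leading_pps \<sigma> J) \<subseteq> carrier (poly_ring V :: 'k mpoly ring)"
    "pp_poly ` M \<subseteq> carrier (poly_ring V :: 'k mpoly ring)"
    using leading_pps_sub M_sub by auto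
  have LT_ideal_J: "LT_ideal V \<sigma> J = Idl\<^bsub>poly_ring V\<^esub> (pp_poly ` (leading_pps \<sigma> J))"
    by (simp add: LT_ideal_def leading_pps_def image_image)
  \<comment> \<open>The minimal leading terms generate the leading term ideal, because every leading
    term is a multiple of one of them.\<close>
  have "LT_ideal V \<sigma> (g ` M) = LT_ideal V \<sigma> J"
    unfolding LT_ideal_g[OF subset_refl] LT_ideal_J
  proof (rule equalityI; rule genideal_poly_ring_minimal)
    show "pp_poly ` M \<subseteq> Idl\<^bsub>poly_ring V\<^esub> (pp_poly ` (leading_pps \<sigma> J) :: 'k mpoly set)"
      using genideal_poly_ring(2)[OF sub_carr(1)] M_sub by blast
    show "pp_poly ` (leading_pps \<sigma> J) \<subseteq> Idl\<^bsub>poly_ring V\<^esub> (pp_poly ` M :: 'k mpoly set)"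
    proof
      fix x :: "'k mpoly" assume "x \<in> pp_poly ` (leading_pps \<sigma> J)"
      then obtain t where t: "t \<in> leading_pps \<sigma> J" "x = pp_poly t" by blast
      then obtain m u where mu: "m \<in> M" "t = m + u"
        using minimal_pps_divides[OF leading_pps_sub] unfolding M_def by blast
      have "x = pp_poly u * pp_poly m" using t mu by (simp add: pp_poly_add mult.commute)
      moreover have "pp_poly u \<in> carrier (poly_ring V :: 'k mpoly ring)"
        using pps_addD[of m u V] t(1) leading_pps_sub by (auto simp: mu(2))
      ultimately show "x \<in> Idl\<^bsub>poly_ring V\<^esub> (pp_poly ` M)"
        using mu(1) genideal_poly_ring(2)[OF sub_carr(2)]
          ideal_poly_ringD(4)[OF genideal_poly_ring(1)[OF sub_carr(2)]] by blast
    qed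
  qed (rule genideal_poly_ring[OF sub_carr(1)] genideal_poly_ring[OF sub_carr(2)])+
  moreover have "finite (g ` M)"
    using finite_minimal_pps[OF fin leading_pps_sub] by (simp add: M_def)
  moreover have "g ` M \<subseteq> J - {0}"
    using N(2) g_nz by (auto simp: g_def)
  ultimately have "groebner_basis V \<sigma> J (g ` M)"
    by (simp add: groebner_basis_def)
  \<comment> \<open>Reducedness: if \<open>t\<close> were a multiple of another minimal leading term
    \<open>m'\<close>, it would be a leading term itself, so \<open>t = m\<close>, and minimality of
    \<open>m\<close> would give \<open>m' = m\<close>.\<close>
  moreover have "pp_poly t \<notin> LT_ideal V \<sigma> (g ` M - {g m})" if m: "m \<in> M" "t \<in> keys (g m)" for m t
  proof
    assume in_ideal: "pp_poly t \<in> LT_ideal V \<sigma> (g ` M - {g m})"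
    \<comment> \<open>The leading term of \<open>g m\<close> recovers \<open>m\<close>, so removing
      \<open>g m\<close> from the basis amounts to removing \<open>m\<close> from
      \<open>M\<close>.\<close>
    have "inj_on g M" using LT_g by (metis inj_onI)
    then have "g ` M - {g m} = g ` (M - {m})"
      using m(1) by (auto simp: inj_on_def)
    then have "pp_poly t \<in> Idl\<^bsub>poly_ring V\<^esub> (pp_poly ` (M - {m}) :: 'k mpoly set)"
      using in_ideal LT_ideal_g[of "M - {m}"] by auto
    then have "\<exists>m'\<in>M - {m}. \<exists>u. t = m' + u"
      using M_sub leading_pps_sub by (intro monomial_ideal_membership) auto
    then obtain m' u where m': "m' \<in> M - {m}" "t = m' + u" by blast
    have "t \<in> pps V" using m(2) keys_g[OF m] m(1) M_sub leading_pps_sub term_ordering_sub by blast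
    then have "t \<in> leading_pps \<sigma> J"
      using leading_pps_add[of m' u] m'(1) M_sub pps_addD[of m' u V] by (auto simp: m'(2))
    then have "m = m' + u" using keys_g[OF m] m'(2) by blast
    then have "m' = m" using m(1) m'(1) M_sub unfolding M_def minimal_pps_def by blast
    then show False using m'(1) by blast
  qed
  moreover have "LC \<sigma> (g m) = 1" if "m \<in> M" for m
    using that LT_g coeff_g by (simp add: LC_def)
  ultimately have "reduced_groebner_basis V \<sigma> J (g ` M)"
    by (auto simp: reduced_groebner_basis_def)
  moreover have "\<forall>m\<in>M. N m \<in> carrier (poly_ring V) \<and> keys (N m) \<inter> (leading_pps \<sigma> J) = {}"
    using N(1,3) by blast
  ultimately show ?thesis
    unfolding M_def g_def by (intro exI[of _ N]) simp
qed


end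

end

text \<open>The indeterminates in \<open>Z\<close> are minimal leading terms. Multiples of leading
  terms are leading terms, so normal forms avoid \<open>Z\<close>, and so do the other minimal
  leading terms.\<close>

lemma separating_groebner_basis:
  fixes J :: "'k::field mpoly set"
  assumes \<sigma>: "term_ordering V \<sigma>" and fin: "finite V" and J: "ideal J (poly_ring V)"
    and sub: "J \<subseteq> irrelevant_ideal V" and Z: "set Z \<subseteq> V" and sep: "separating_for V \<sigma> J Z"
  shows "\<exists>h p. (\<forall>j<length Z. h j \<in> carrier (poly_ring (V - set Z))) \<and>
    p \<subseteq> carrier (poly_ring (V - set Z)) \<and>
    reduced_groebner_basis V \<sigma> J ((\<lambda>j. indet (Z ! j) - h j) ` {..<length Z} \<union> p)"
proof -
  define L where "L = leading_pps \<sigma> J"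
  note L_sub = leading_pps_sub[OF \<sigma> fin J, folded L_def]
  note L_add = leading_pps_add[OF \<sigma> fin J, folded L_def]
  define M where "M = minimal_pps L"
  have M_L: "M \<subseteq> L" by (auto simp: M_def minimal_pps_def)
  have M_min: "s = m" if "m \<in> M" "s \<in> L" "m = s + u" for m s u
    using that unfolding M_def minimal_pps_def by blast
  have M_I: "m \<in> M" if "m \<in> L" "\<And>s u. s \<in> L \<Longrightarrow> m = s + u \<Longrightarrow> s = m" for m
    using that unfolding M_def minimal_pps_def by blast
  obtain N where N0: "\<forall>m\<in>M. N m \<in> carrier (poly_ring V) \<and> keys (N m) \<inter> L = {}"
      and N3: "reduced_groebner_basis V \<sigma> J ((\<lambda>m. pp_poly m - N m) ` M)"
    using reduced_groebner_basis_exists[OF \<sigma> fin J, folded L_def M_def] by (elim exE conjE)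
  have N: "N m \<in> carrier (poly_ring V)" "s \<in> keys (N m) \<Longrightarrow> s \<notin> L" if "m \<in> M" for m s
    using N0 that by auto
  have Z_lead: "indet_pp z \<in> L" if z: "z \<in> set Z" for z
  proof -
    obtain j where j: "j < length Z" "Z ! j = z" using z unfolding in_set_conv_nth by blast
    have "\<exists>g\<in>J - {0}. LT \<sigma> g = indet_pp (Z ! j)"
      using sep j(1) unfolding separating_for_def by blast
    then obtain g where g: "g \<in> J - {0}" "LT \<sigma> g = indet_pp z"
      unfolding j(2) by blast
    show ?thesis unfolding L_def leading_pps_def using imageI[OF g(1), of "LT \<sigma>"] g(2) by simp
  qed
  \<comment> \<open>An element of \<open>J\<close> with leading term 1 would have a non-zero
    constant term, contrary to \<open>sub\<close>.\<close>
  have zero: "0 \<notin> L"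
  proof
    assume "0 \<in> L"
    then obtain f where f: "f \<in> J" "f \<noteq> 0" "LT \<sigma> f = 0"
      unfolding L_def leading_pps_def by force
    then have "f \<in> carrier (poly_ring V)" using ideal_poly_ringD(1)[OF J] by blast
    from LT_props(1)[OF \<sigma> fin this f(2)] have "coeff f 0 \<noteq> 0" by (simp add: f(3) in_keys_iff)
    then show False using f(1) sub by (auto simp: irrelevant_ideal_eq)
  qed
  have Z_min: "indet_pp z \<in> M" if z: "z \<in> set Z" for z
  proof (rule M_I)
    show "indet_pp z \<in> L" using Z_lead[OF z] .
    show "s = indet_pp z" if "s \<in> L" "indet_pp z = s + u" for s u
      using sum_is_indet_pp[THEN iffD1, OF that(2)[symmetric]] that(1) zero by blast
  qed
  have reduced: "t \<in> pps (V - set Z)"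
    if t: "t \<in> pps V" "\<And>z u. z \<in> set Z \<Longrightarrow> t \<noteq> indet_pp z + u" for t
  proof -
    have "z \<notin> set Z" if z: "z \<in> keys t" for z
    proof
      assume "z \<in> set Z"
      moreover have "t = indet_pp z + (t - indet_pp z)"
        by (rule poly_mapping_eqI)
          (use z in \<open>auto simp: lookup_add lookup_minus indet_pp_def lookup_single when_def in_keys_iff\<close>)
      ultimately show False using t(2) by blast
    qed
    then show ?thesis using t(1) by (auto simp: pps_def)
  qed
  have N_Y: "N m \<in> carrier (poly_ring (V - set Z))" if m: "m \<in> M" for m
    unfolding carrier_poly_ring
  proof (intro CollectI subsetI reduced)
    fix s assume s: "s \<in> keys (N m)"
    then show s_pps: "s \<in> pps V" using N(1)[OF m] by (auto simp: carrier_poly_ring)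
    fix z u assume z: "z \<in> set Z"
    show "s \<noteq> indet_pp z + u"
    proof
      assume eq: "s = indet_pp z + u"
      then have "u \<in> pps V" using pps_addD[of "indet_pp z" u V] s_pps by simp
      then have "s \<in> L" unfolding eq by (rule L_add[OF Z_lead[OF z]])
      then show False using N(2)[OF m s] by blast
    qed
  qed
  \<comment> \<open>These minimal leading terms yield the basis elements \<open>p\<close> in K[Y]: a
    minimal leading term divisible by some \<open>indet_pp z\<close> would equal it.\<close>
  define B where "B = M - indet_pp ` set Z"
  have B_Y: "m \<in> pps (V - set Z)" if m: "m \<in> B" for m
  proof (rule reduced)
    show "m \<in> pps V" using m L_sub M_L by (auto simp: B_def)
    fix z u assume z: "z \<in> set Z"
    show "m \<noteq> indet_pp z + u"
    proof
      assume "m = indet_pp z + u"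
      then have "indet_pp z = m" using M_min[OF _ Z_lead[OF z], of m u] m by (simp add: B_def)
      then show False using m z by (auto simp: B_def)
    qed
  qed
  have "indet_pp ` set Z = (\<lambda>j. indet_pp (Z ! j)) ` {..<length Z}"
    by (auto simp: set_conv_nth)
  moreover have "M = indet_pp ` set Z \<union> B"
    using Z_min unfolding B_def by blast
  ultimately have "(\<lambda>m. pp_poly m - N m) ` M =
      (\<lambda>j. indet (Z ! j) - N (indet_pp (Z ! j))) ` {..<length Z} \<union> (\<lambda>m. pp_poly m - N m) ` B"
    by (simp add: image_Un image_image indet_def)
  moreover have "(\<lambda>m. pp_poly m - N m) ` B \<subseteq> carrier (poly_ring (V - set Z))"
    using B_Y N_Y by (auto simp: B_def)
  moreover have "N (indet_pp (Z ! j)) \<in> carrier (poly_ring (V - set Z))" if "j < length Z" for j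
    using N_Y[OF Z_min] that by simp
  ultimately show ?thesis using N3
    by (intro exI[of _ "\<lambda>j. N (indet_pp (Z ! j))"] exI[of _ "(\<lambda>m. pp_poly m - N m) ` B"]) auto
qed

section \<open>Substitution and Krull dimension\<close>

definition subst_pp :: "(nat \<Rightarrow> 'k::field mpoly) \<Rightarrow> pp \<Rightarrow> 'k mpoly" where
  "subst_pp s t = (\<Prod>i\<in>Poly_Mapping.keys t. s i ^ coeff t i)"

definition subst_poly :: "(nat \<Rightarrow> 'k::field mpoly) \<Rightarrow> 'k mpoly \<Rightarrow> 'k mpoly" where
  "subst_poly s p = (\<Sum>t\<in>keys p. const (coeff p t) * subst_pp s t)"

lemma subst_pp_add: "subst_pp s (t + u) = subst_pp s t * subst_pp s u"
proof -
  let ?A = "keys t \<union> keys u"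
  have eq: "subst_pp s v = (\<Prod>i\<in>?A. s i ^ coeff v i)" if "keys v \<subseteq> ?A" for v
    unfolding subst_pp_def by (rule prod.mono_neutral_left) (use that in \<open>auto simp: in_keys_iff\<close>)
  have "keys (t + u) \<subseteq> ?A" by (rule keys_add)
  then show ?thesis
    by (simp add: eq lookup_add power_add prod.distrib)
qed

lemma subst_poly_single: "subst_poly s (const c * pp_poly t) = const c * subst_pp s t"
  by (cases "c = 0") (simp_all add: subst_poly_def const_mult_pp_poly)

lemma subst_poly_0 [simp]: "subst_poly s 0 = 0"
  by (simp add: subst_poly_def)

lemma subst_poly_const [simp]: "subst_poly s (const c) = const c"
  using subst_poly_single[of s c 0] by (simp add: subst_pp_def)

lemma subst_poly_indet [simp]: "subst_poly s (indet i) = s i"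
  using subst_poly_single[of s 1 "indet_pp i"]
  by (simp add: subst_pp_def indet_def) (simp add: indet_pp_def)

lemma subst_poly_add: "subst_poly s (p + q) = subst_poly s p + subst_poly s q"
proof -
  let ?A = "keys p \<union> keys q"
  have eq: "subst_poly s v = (\<Sum>t\<in>?A. const (coeff v t) * subst_pp s t)" if "keys v \<subseteq> ?A" for v
    unfolding subst_poly_def by (rule sum.mono_neutral_left) (use that in \<open>auto simp: in_keys_iff\<close>)
  have "keys (p + q) \<subseteq> ?A" by (rule keys_add)
  then show ?thesis
    by (simp add: eq lookup_add const_add distrib_right sum.distrib)
qed

lemma subst_poly_mult:
  fixes p q :: "'k::field mpoly"
  shows "subst_poly s (p * q) = subst_poly s p * subst_poly s q"
proof (rule bilinear_ext[where F = "\<lambda>p q. subst_poly s (p * q)" and G = "\<lambda>p q. subst_poly s p * subst_poly s q"])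
  fix t u and c d :: 'k
  have "const c * pp_poly t * (const d * pp_poly u) = const (c * d) * pp_poly (t + u)"
    by (simp add: const_mult pp_poly_add algebra_simps)
  then have "subst_poly s (const c * pp_poly t * (const d * pp_poly u)) = const (c * d) * subst_pp s (t + u)"
    by (simp only: subst_poly_single)
  then show "subst_poly s (const c * pp_poly t * (const d * pp_poly u)) =
      subst_poly s (const c * pp_poly t) * subst_poly s (const d * pp_poly u)"
    by (simp only: subst_poly_single const_mult subst_pp_add mult_ac)
qed (simp_all add: subst_poly_add distrib_left distrib_right)

lemma subst_poly_closed:
  assumes "p \<in> carrier (poly_ring V)" "\<And>i. i \<in> V \<Longrightarrow> s i \<in> carrier (poly_ring W)"
  shows "subst_poly s p \<in> carrier (poly_ring W)"
  using assms(1)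
  by (induction rule: poly_ring_induct) (simp_all add: assms(2) subst_poly_add subst_poly_mult)

text \<open>Along a surjective homomorphism, a strict chain of primes pulls back to a strict chain
  of primes; strictness comes from lifting an element of the difference.\<close>

lemma krull_dim_surj_le:
  fixes R :: "('a, 'm) ring_scheme" and S :: "('b, 'n) ring_scheme"
  assumes "ring_hom_ring R S h" "cring R" "h ` carrier R = carrier S"
  shows "krull_dim S \<le> krull_dim R"
proof -
  define pull where "pull P = {r \<in> carrier R. h r \<in> P}" for P
  have prime: "primeideal (pull P) R" if "primeideal P S" for P
    unfolding pull_def by (rule ring_hom_ring.primeideal_vimage[OF assms(1,2) that])
  have strict: "pull P \<subset> pull Q" if Q: "primeideal Q S" and PQ: "P \<subset> Q" for P Q
  proof -
    obtain x where x: "x \<in> Q" "x \<notin> P" using PQ by blast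
    have "x \<in> carrier S"
      by (rule ideal.Icarr[OF primeideal.axioms(1)[OF Q] x(1)])
    then have "x \<in> h ` carrier R" by (simp only: assms(3))
    then obtain r where "r \<in> carrier R" "h r = x" by blast
    then have "r \<in> pull Q" "r \<notin> pull P" using x by (simp_all add: pull_def)
    moreover have "pull P \<subseteq> pull Q" using PQ unfolding pull_def by blast
    ultimately show ?thesis by blast
  qed
  show ?thesis
    unfolding krull_dim_def
  proof (rule Sup_subset_mono, rule subsetI)
    fix d assume "d \<in> {enat k | k. \<exists>\<pp>. (\<forall>i\<le>k. primeideal (\<pp> i) S) \<and> (\<forall>i<k. \<pp> i \<subset> \<pp> (Suc i))}"
    then obtain k \<pp> where k: "d = enat k" "\<forall>i\<le>k. primeideal (\<pp> i) S" "\<forall>i<k. \<pp> i \<subset> \<pp> (Suc i)"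
      by blast
    have "\<forall>i\<le>k. primeideal (pull (\<pp> i)) R" using k(2) prime by blast
    moreover have "\<forall>i<k. pull (\<pp> i) \<subset> pull (\<pp> (Suc i))"
    proof (intro allI impI)
      fix i assume "i < k"
      then show "pull (\<pp> i) \<subset> pull (\<pp> (Suc i))"
        using k(2)[rule_format, of "Suc i"] k(3)[rule_format, of i] by (intro strict) simp_all
    qed
    ultimately have "\<exists>\<qq>. (\<forall>i\<le>k. primeideal (\<qq> i) R) \<and> (\<forall>i<k. \<qq> i \<subset> \<qq> (Suc i))"
      by (intro exI[of _ "\<lambda>i. pull (\<pp> i)"]) simp
    then show "d \<in> {enat k | k. \<exists>\<qq>. (\<forall>i\<le>k. primeideal (\<qq> i) R) \<and> (\<forall>i<k. \<qq> i \<subset> \<qq> (Suc i))}"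
      using k(1) by (intro CollectI exI[of _ k] conjI)
  qed
qed

text \<open>Optimality compares Krull dimensions, and this reduces it to counting indeterminates:
  K[W] maps onto K[Y], so the dimensions are compared without being computed.\<close>

lemma krull_dim_poly_ring_mono:
  assumes "finite Y" "finite W" "card Y \<le> card W"
  shows "krull_dim (poly_ring Y :: 'k::field mpoly ring) \<le> krull_dim (poly_ring W :: 'k mpoly ring)"
proof -
  obtain e where e: "e ` Y \<subseteq> W" "inj_on e Y"
    using card_le_inj[OF assms] by blast
  \<comment> \<open>The substitution inverts the embedding \<open>e\<close> on its image and sends
    the remaining indeterminates of \<open>W\<close> to 0.\<close>
  define s :: "nat \<Rightarrow> 'k mpoly" where
    "s w = (if w \<in> e ` Y then indet (inv_into Y e w) else 0)" for w
  have s: "s w \<in> carrier (poly_ring Y)" for w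
    by (auto simp: s_def e(2))
  have hom: "ring_hom_ring (poly_ring W) (poly_ring Y) (subst_poly s)"
  proof (rule ring_hom_ringI[OF ring_poly_ring ring_poly_ring])
    show "subst_poly s \<one>\<^bsub>poly_ring W\<^esub> = \<one>\<^bsub>poly_ring Y\<^esub>"
      using subst_poly_const[of s 1] by simp
  qed (simp_all add: subst_poly_add subst_poly_mult subst_poly_closed s)
  have "\<exists>q\<in>carrier (poly_ring W). p = subst_poly s q" if "p \<in> carrier (poly_ring Y)" for p
    using that
  proof (induction rule: poly_ring_induct)
    case (const c)
    show ?case by (rule bexI[of _ "const c"]) auto
  next
    case (indet i)
    then have "s (e i) = indet i" "e i \<in> W" using e by (auto simp: s_def)
    then show ?case by (intro bexI[of _ "indet (e i)"]) simp_all
  next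
    case (add p q)
    then obtain p' q' where "p' \<in> carrier (poly_ring W)" "q' \<in> carrier (poly_ring W)"
      "p = subst_poly s p'" "q = subst_poly s q'" by blast
    then show ?case by (intro bexI[of _ "p' + q'"]) (simp_all add: subst_poly_add)
  next
    case (mult p q)
    then obtain p' q' where "p' \<in> carrier (poly_ring W)" "q' \<in> carrier (poly_ring W)"
      "p = subst_poly s p'" "q = subst_poly s q'" by blast
    then show ?case by (intro bexI[of _ "p' * q'"]) (simp_all add: subst_poly_mult)
  qed
  then have "subst_poly s ` carrier (poly_ring W) = carrier (poly_ring Y)"
    using s subst_poly_closed by blast
  then show ?thesis
    by (rule krull_dim_surj_le[OF hom cring_poly_ring])
qed

section \<open>The separating re-embedding\<close>

lemma poly_ring_mono: "Y \<subseteq> V \<Longrightarrow> carrier (poly_ring Y) \<subseteq> carrier (poly_ring V)"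
  by (auto simp: carrier_poly_ring pps_def)

lemma K_algebra_isoD:
  assumes "K_algebra_iso V J W J' \<phi>" and "A \<in> carrier (poly_ring V Quot J)" "B \<in> carrier (poly_ring V Quot J)"
  shows "\<phi> (A \<oplus>\<^bsub>poly_ring V Quot J\<^esub> B) = \<phi> A \<oplus>\<^bsub>poly_ring W Quot J'\<^esub> \<phi> B"
    and "\<phi> (A \<otimes>\<^bsub>poly_ring V Quot J\<^esub> B) = \<phi> A \<otimes>\<^bsub>poly_ring W Quot J'\<^esub> \<phi> B"
  using assms by (auto simp: K_algebra_iso_def dest: ring_iso_memE)

context
  fixes V Y :: "nat set" and J :: "'k::field mpoly set"
  assumes J: "ideal J (poly_ring V)" and Y: "Y \<subseteq> V"
begin

lemma ideal_contracted_ideal: "ideal (contracted_ideal J Y) (poly_ring Y)"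
  using poly_ring_mono[OF Y] ideal_poly_ringD[OF J]
  by (intro ideal_poly_ringI) (auto simp: subset_iff)

text \<open>Intersecting with K[Y] describes the re-embedding on cosets without choosing
  representatives or a term ordering.\<close>

lemma coset_inter_carrier:
  assumes q: "q \<in> carrier (poly_ring Y)" "p - q \<in> J"
  shows "(J +>\<^bsub>poly_ring V\<^esub> p) \<inter> carrier (poly_ring Y) = contracted_ideal J Y +>\<^bsub>poly_ring Y\<^esub> q"
proof (intro equalityI subsetI)
  fix x assume "x \<in> (J +>\<^bsub>poly_ring V\<^esub> p) \<inter> carrier (poly_ring Y)"
  then obtain h where h: "h \<in> J" "x = h + p" "x \<in> carrier (poly_ring Y)"
    by (auto simp: coset_poly_ring)
  have "x - q = h + (p - q)" using h by simp
  then have "x - q \<in> J"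
    using ideal_poly_ringD(3)[OF J h(1) q(2)] by (simp only:)
  then have "x - q \<in> contracted_ideal J Y"
    using h(3) q(1) by simp
  then have "(x - q) + q \<in> (\<lambda>h. h + q) ` contracted_ideal J Y" by (rule imageI)
  then show "x \<in> contracted_ideal J Y +>\<^bsub>poly_ring Y\<^esub> q" by (simp add: coset_poly_ring)
next
  fix x assume "x \<in> contracted_ideal J Y +>\<^bsub>poly_ring Y\<^esub> q"
  then obtain h where h: "h \<in> J" "h \<in> carrier (poly_ring Y)" "x = h + q"
    by (auto simp: coset_poly_ring)
  have "h - (p - q) \<in> J" using ideal_poly_ringD(6)[OF J h(1) q(2)] .
  then have "(h - (p - q)) + p \<in> (\<lambda>h. h + p) ` J" by (rule imageI)
  then show "x \<in> (J +>\<^bsub>poly_ring V\<^esub> p) \<inter> carrier (poly_ring Y)"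
    using h q(1) by (simp add: coset_poly_ring)
qed

text \<open>The polynomials congruent modulo \<open>J\<close> to an element of K[Y] form a
  subalgebra, so it suffices that it contains all indeterminates.\<close>

lemma poly_ring_reduction:
  assumes "\<And>i. i \<in> V \<Longrightarrow> \<exists>q\<in>carrier (poly_ring Y). indet i - q \<in> J" and "p \<in> carrier (poly_ring V)"
  shows "\<exists>q\<in>carrier (poly_ring Y). p - q \<in> J"
  using assms(2)
proof (induction rule: poly_ring_induct)
  case (const c)
  then show ?case by (intro bexI[of _ "const c"]) (simp_all add: ideal_poly_ringD[OF J])
next
  case (indet i)
  then show ?case by (rule assms(1))
next
  case (add p q)
  then obtain p' q' where *: "p' \<in> carrier (poly_ring Y)" "p - p' \<in> J" "q' \<in> carrier (poly_ring Y)" "q - q' \<in> J"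
    by blast
  have "(p + q) - (p' + q') = (p - p') + (q - q')" by simp
  also have "\<dots> \<in> J" using * by (intro ideal_poly_ringD(3)[OF J])
  finally show ?case using * by (intro bexI[of _ "p' + q'"]) simp_all
next
  case (mult p q)
  then obtain p' q' where *: "p' \<in> carrier (poly_ring Y)" "p - p' \<in> J" "q' \<in> carrier (poly_ring Y)" "q - q' \<in> J"
    by blast
  have "p * q - p' * q' = p * (q - q') + q' * (p - p')" by (simp add: algebra_simps)
  also have "\<dots> \<in> J" using * mult.hyps poly_ring_mono[OF Y]
    by (intro ideal_poly_ringD(3)[OF J] ideal_poly_ringD(4)[OF J]) auto
  finally show ?case using * by (intro bexI[of _ "p' * q'"]) simp_all
qed

text \<open>The inclusion of K[Y] into P induces an injection of K[Y] modulo the contraction into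
  P/J, surjective by \<open>red\<close>; the map given here is its inverse.\<close>

lemma contraction_iso:
  assumes red: "\<And>i. i \<in> V \<Longrightarrow> \<exists>q\<in>carrier (poly_ring Y). indet i - q \<in> J"
  shows "K_algebra_iso V J Y (contracted_ideal J Y)
    (restrict (\<lambda>C. C \<inter> carrier (poly_ring Y)) (carrier (poly_ring V Quot J)))"
    (is "K_algebra_iso V J Y ?J' ?\<Phi>")
proof -
  note J' = ideal_contracted_ideal
  note red' = poly_ring_reduction[OF red]
  define cl where "cl p = J +>\<^bsub>poly_ring V\<^esub> p" for p
  define cl' where "cl' p = ?J' +>\<^bsub>poly_ring Y\<^esub> p" for p
  have sub: "q \<in> carrier (poly_ring V)" if "q \<in> carrier (poly_ring Y)" for q :: "'k mpoly"
    using poly_ring_mono[OF Y] that by blast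
  \<comment> \<open>Every coset has a representative in K[Y], so all verifications below can be done
    on such representatives.\<close>
  have carr: "carrier (poly_ring V Quot J) = cl ` carrier (poly_ring Y)"
  proof (intro equalityI subsetI)
    fix C assume "C \<in> carrier (poly_ring V Quot J)"
    then obtain p where p: "p \<in> carrier (poly_ring V)" "C = cl p"
      by (auto simp: carrier_quot_poly_ring cl_def)
    then obtain q where "q \<in> carrier (poly_ring Y)" "p - q \<in> J" using red' by blast
    then show "C \<in> cl ` carrier (poly_ring Y)"
      using p(2) coset_eq_iff[OF J, of p q] by (auto simp: cl_def)
  qed (use sub in \<open>auto simp: carrier_quot_poly_ring cl_def\<close>)
  have \<Phi>: "?\<Phi> (cl q) = cl' q" if "q \<in> carrier (poly_ring Y)" for q
    using coset_inter_carrier[OF that, of q] that carr ideal_poly_ringD(2)[OF J]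
    by (simp add: cl_def cl'_def)
  have carr': "carrier (poly_ring Y Quot ?J') = cl' ` carrier (poly_ring Y)"
    by (simp add: carrier_quot_poly_ring cl'_def[abs_def])
  have ops: "cl p \<oplus>\<^bsub>poly_ring V Quot J\<^esub> cl q = cl (p + q)"
    "cl p \<otimes>\<^bsub>poly_ring V Quot J\<^esub> cl q = cl (p * q)"
    "cl' p \<oplus>\<^bsub>poly_ring Y Quot ?J'\<^esub> cl' q = cl' (p + q)"
    "cl' p \<otimes>\<^bsub>poly_ring Y Quot ?J'\<^esub> cl' q = cl' (p * q)"
    if "p \<in> carrier (poly_ring Y)" "q \<in> carrier (poly_ring Y)" for p q
    using quot_poly_ring_ops[OF J, of p q] quot_poly_ring_ops[OF J', of p q] that sub
    by (simp_all add: cl_def cl'_def)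
  have "?\<Phi> \<in> ring_iso (poly_ring V Quot J) (poly_ring Y Quot ?J')"
  proof (rule ring_iso_memI)
    fix A assume "A \<in> carrier (poly_ring V Quot J)"
    then obtain p where p: "p \<in> carrier (poly_ring Y)" "A = cl p" using carr by blast
    then show "?\<Phi> A \<in> carrier (poly_ring Y Quot ?J')" using \<Phi>[OF p(1)] carr' by auto
    fix B assume "B \<in> carrier (poly_ring V Quot J)"
    then obtain q where q: "q \<in> carrier (poly_ring Y)" "B = cl q" using carr by blast
    have pq: "p + q \<in> carrier (poly_ring Y)" "p * q \<in> carrier (poly_ring Y)" using p q by simp_all
    show "?\<Phi> (A \<otimes>\<^bsub>poly_ring V Quot J\<^esub> B) = ?\<Phi> A \<otimes>\<^bsub>poly_ring Y Quot ?J'\<^esub> ?\<Phi> B"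
      unfolding p(2) q(2) ops(2)[OF p(1) q(1)] \<Phi>[OF p(1)] \<Phi>[OF q(1)] \<Phi>[OF pq(2)] ops(4)[OF p(1) q(1)] ..
    show "?\<Phi> (A \<oplus>\<^bsub>poly_ring V Quot J\<^esub> B) = ?\<Phi> A \<oplus>\<^bsub>poly_ring Y Quot ?J'\<^esub> ?\<Phi> B"
      unfolding p(2) q(2) ops(1)[OF p(1) q(1)] \<Phi>[OF p(1)] \<Phi>[OF q(1)] \<Phi>[OF pq(1)] ops(3)[OF p(1) q(1)] ..
  next
    have one: "\<one>\<^bsub>poly_ring V Quot J\<^esub> = cl 1" "\<one>\<^bsub>poly_ring Y Quot ?J'\<^esub> = cl' 1"
      by (simp_all add: FactRing_def cl_def cl'_def)
    show "?\<Phi> \<one>\<^bsub>poly_ring V Quot J\<^esub> = \<one>\<^bsub>poly_ring Y Quot ?J'\<^esub>"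
      unfolding one by (rule \<Phi>) simp
  next
    have "inj_on ?\<Phi> (cl ` carrier (poly_ring Y))"
    proof (rule inj_onI)
      fix A B assume "A \<in> cl ` carrier (poly_ring Y)" "B \<in> cl ` carrier (poly_ring Y)" and eq: "?\<Phi> A = ?\<Phi> B"
      then obtain p q where pq: "p \<in> carrier (poly_ring Y)" "A = cl p" "q \<in> carrier (poly_ring Y)" "B = cl q"
        by blast
      have "cl' p = cl' q" using eq unfolding pq(2,4) \<Phi>[OF pq(1)] \<Phi>[OF pq(3)] .
      then have "p - q \<in> J" unfolding cl'_def coset_eq_iff[OF J'] by blast
      then show "A = B" unfolding pq cl_def coset_eq_iff[OF J] .
    qed
    moreover have "?\<Phi> ` cl ` carrier (poly_ring Y) = cl' ` carrier (poly_ring Y)"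
      unfolding image_image by (rule image_cong) (simp_all only: \<Phi>)
    ultimately show "bij_betw ?\<Phi> (carrier (poly_ring V Quot J)) (carrier (poly_ring Y Quot ?J'))"
      unfolding carr carr' bij_betw_def by blast
  qed
  moreover have "?\<Phi> (cl (const c)) = cl' (const c)" for c
    by (rule \<Phi>) simp
  ultimately show ?thesis unfolding K_algebra_iso_def cl_def cl'_def by blast
qed

end

text \<open>A homomorphism is determined by its values on constants and indeterminates. As each
  \<open>indet (Z ! j)\<close> is congruent to \<open>h j\<close>, these values are those of the
  intersection map, whatever \<sigma> and \<open>h\<close> are; this is the uniqueness behind
  \<open>separating_reembedding\<close>.\<close>

lemma is_separating_reembedding_imp_eq:
  fixes J :: "'k::field mpoly set"
  assumes J: "ideal J (poly_ring V)" and \<Phi>: "is_separating_reembedding V J Z \<Phi>"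
  shows "\<Phi> = restrict (\<lambda>C. C \<inter> carrier (poly_ring (V - set Z))) (carrier (poly_ring V Quot J))"
proof -
  define Y where "Y = V - set Z"
  have Y: "Y \<subseteq> V" by (auto simp: Y_def)
  note J' = ideal_contracted_ideal[OF J Y]
  define cl where "cl p = J +>\<^bsub>poly_ring V\<^esub> p" for p
  define cl' where "cl' p = contracted_ideal J Y +>\<^bsub>poly_ring Y\<^esub> p" for p
  have ext: "\<Phi> \<in> extensional (carrier (poly_ring V Quot J))"
    and iso: "K_algebra_iso V J Y (contracted_ideal J Y) \<Phi>"
    using \<Phi> unfolding is_separating_reembedding_def Let_def Y_def[symmetric] by blast+
  obtain h p \<sigma> where h: "\<forall>j<length Z. h j \<in> carrier (poly_ring Y)"
    and gb: "reduced_groebner_basis V \<sigma> J ((\<lambda>j. indet (Z ! j) - h j) ` {..<length Z} \<union> p)"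
    and \<Phi>Y: "\<forall>i\<in>Y. \<Phi> (cl (indet i)) = cl' (indet i)"
    and \<Phi>Z: "\<forall>j<length Z. \<Phi> (cl (indet (Z ! j))) = cl' (h j)"
    using \<Phi> unfolding is_separating_reembedding_def Let_def Y_def[symmetric] cl_def cl'_def by blast
  have zh: "indet (Z ! j) - h j \<in> J" if "j < length Z" for j
    using gb that by (auto simp: reduced_groebner_basis_def groebner_basis_def)
  \<comment> \<open>The congruence modulo \<open>J\<close> and the value of \<Phi> are carried
    through the induction together, so that \<open>coset_inter_carrier\<close> applies at the
    end.\<close>
  have main: "\<exists>q\<in>carrier (poly_ring Y). p - q \<in> J \<and> \<Phi> (cl p) = cl' q" if "p \<in> carrier (poly_ring V)" for p
    using that
  proof (induction rule: poly_ring_induct)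
    case (const c)
    have "\<Phi> (cl (const c)) = cl' (const c)" using iso unfolding K_algebra_iso_def cl_def cl'_def by blast
    then show ?case by (intro bexI[of _ "const c"]) (simp_all add: ideal_poly_ringD[OF J])
  next
    case (indet i)
    show ?case
    proof (cases "i \<in> set Z")
      case True
      then obtain j where "j < length Z" "Z ! j = i" by (auto simp: in_set_conv_nth)
      then show ?thesis using h zh \<Phi>Z by (intro bexI[of _ "h j"]) auto
    next
      case False
      then have "i \<in> Y" using indet by (simp add: Y_def)
      then show ?thesis using \<Phi>Y by (intro bexI[of _ "indet i"]) (auto simp: ideal_poly_ringD[OF J])
    qed
  next
    case (add p q)
    then obtain p' q' where *: "p' \<in> carrier (poly_ring Y)" "p - p' \<in> J" "\<Phi> (cl p) = cl' p'"
      "q' \<in> carrier (poly_ring Y)" "q - q' \<in> J" "\<Phi> (cl q) = cl' q'"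
      by blast
    have "(p + q) - (p' + q') = (p - p') + (q - q')" by simp
    also have "\<dots> \<in> J" using * by (intro ideal_poly_ringD(3)[OF J])
    finally have diff: "(p + q) - (p' + q') \<in> J" .
    have "\<Phi> (cl (p + q)) = cl' (p' + q')"
      using K_algebra_isoD(1)[OF iso, of "cl p" "cl q"] add.hyps *
        quot_poly_ring_ops(1)[OF J add.hyps] quot_poly_ring_ops(1)[OF J' *(1,4)]
      by (simp add: carrier_quot_poly_ring cl_def cl'_def)
    then show ?case using * diff by (intro bexI[of _ "p' + q'"]) simp_all
  next
    case (mult p q)
    then obtain p' q' where *: "p' \<in> carrier (poly_ring Y)" "p - p' \<in> J" "\<Phi> (cl p) = cl' p'"
      "q' \<in> carrier (poly_ring Y)" "q - q' \<in> J" "\<Phi> (cl q) = cl' q'"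
      by blast
    have "p * q - p' * q' = p * (q - q') + q' * (p - p')" by (simp add: algebra_simps)
    also have "\<dots> \<in> J" using * mult.hyps poly_ring_mono[OF Y]
      by (intro ideal_poly_ringD(3)[OF J] ideal_poly_ringD(4)[OF J]) auto
    finally have "p * q - p' * q' \<in> J" .
    moreover have "\<Phi> (cl (p * q)) = cl' (p' * q')"
      using K_algebra_isoD(2)[OF iso, of "cl p" "cl q"] mult.hyps *
        quot_poly_ring_ops(2)[OF J mult.hyps] quot_poly_ring_ops(2)[OF J' *(1,4)]
      by (simp add: carrier_quot_poly_ring cl_def cl'_def)
    ultimately show ?case using * by (intro bexI[of _ "p' * q'"]) simp_all
  qed
  show ?thesis
  proof (rule extensionalityI[OF ext])
    fix C assume C: "C \<in> carrier (poly_ring V Quot J)"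
    then obtain p where p: "p \<in> carrier (poly_ring V)" "C = cl p"
      by (auto simp: carrier_quot_poly_ring cl_def)
    then obtain q where "q \<in> carrier (poly_ring Y)" "p - q \<in> J" "\<Phi> (cl p) = cl' q" using main by blast
    then show "\<Phi> C = restrict (\<lambda>C. C \<inter> carrier (poly_ring (V - set Z))) (carrier (poly_ring V Quot J)) C"
      using coset_inter_carrier[OF J Y] p C by (simp add: cl_def cl'_def flip: Y_def)
  qed simp
qed

lemma separating_reduction:
  fixes J :: "'k::field mpoly set"
  assumes J: "ideal J (poly_ring V)"
    and h: "\<forall>j<length Z. h j \<in> carrier (poly_ring (V - set Z))"
    and gb: "reduced_groebner_basis V \<sigma> J ((\<lambda>j. indet (Z ! j) - h j) ` {..<length Z} \<union> p)"
    and i: "i \<in> V"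
  shows "\<exists>q\<in>carrier (poly_ring (V - set Z)). indet i - q \<in> J"
proof (cases "i \<in> set Z")
  case True
  then obtain j where j: "j < length Z" "Z ! j = i" by (auto simp: in_set_conv_nth)
  have "indet (Z ! j) - h j \<in> J"
    using gb j(1) by (auto simp: reduced_groebner_basis_def groebner_basis_def)
  then show ?thesis using h j by blast
next
  case False
  then show ?thesis
    using i by (intro bexI[of _ "indet i"]) (simp_all add: ideal_poly_ringD(2)[OF J])
qed

text \<open>Existence comes from the reduced Groebner basis and the intersection map; together with
  uniqueness it shows that the definite description denotes the intended map.\<close>

lemma separating_reembedding_correct:
  fixes J :: "'k::field mpoly set"
  assumes fin: "finite V" and J: "ideal J (poly_ring V)" and sub: "J \<subseteq> irrelevant_ideal V"
    and Z: "set Z \<subseteq> V" and sep: "separating V J Z"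
  shows "is_separating_reembedding V J Z (separating_reembedding V J Z)"
    and "i \<in> V \<Longrightarrow> \<exists>q\<in>carrier (poly_ring (V - set Z)). indet i - q \<in> J"
proof -
  define Y where "Y = V - set Z"
  have Y: "Y \<subseteq> V" by (auto simp: Y_def)
  obtain \<sigma> where \<sigma>: "separating_for V \<sigma> J Z"
    using sep unfolding separating_def by blast
  then have ord: "term_ordering V \<sigma>" by (simp add: separating_for_def)
  obtain h p where h: "\<forall>j<length Z. h j \<in> carrier (poly_ring Y)" and p: "p \<subseteq> carrier (poly_ring Y)"
    and gb: "reduced_groebner_basis V \<sigma> J ((\<lambda>j. indet (Z ! j) - h j) ` {..<length Z} \<union> p)"
    using separating_groebner_basis[OF ord fin J sub Z \<sigma>, folded Y_def] by (elim exE conjE)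
  note red = separating_reduction[OF J h[unfolded Y_def] gb, folded Y_def]
  then show "i \<in> V \<Longrightarrow> \<exists>q\<in>carrier (poly_ring (V - set Z)). indet i - q \<in> J"
    by (simp add: Y_def)
  define \<Phi> where "\<Phi> = restrict (\<lambda>C. C \<inter> carrier (poly_ring Y)) (carrier (poly_ring V Quot J))"
  have \<Phi>: "\<Phi> (J +>\<^bsub>poly_ring V\<^esub> p) = contracted_ideal J Y +>\<^bsub>poly_ring Y\<^esub> q"
    if "p \<in> carrier (poly_ring V)" "q \<in> carrier (poly_ring Y)" "p - q \<in> J" for p q
    using coset_inter_carrier[OF J Y that(2,3)] that(1) by (simp add: \<Phi>_def carrier_quot_poly_ring)
  have zh: "indet (Z ! j) - h j \<in> J" if "j < length Z" for j
    using gb that by (auto simp: reduced_groebner_basis_def groebner_basis_def)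
  have "\<forall>i\<in>Y. \<Phi> (J +>\<^bsub>poly_ring V\<^esub> indet i) = contracted_ideal J Y +>\<^bsub>poly_ring Y\<^esub> indet i"
    using Y ideal_poly_ringD(2)[OF J] by (intro ballI \<Phi>) auto
  moreover have "\<forall>j<length Z. \<Phi> (J +>\<^bsub>poly_ring V\<^esub> indet (Z ! j)) = contracted_ideal J Y +>\<^bsub>poly_ring Y\<^esub> h j"
  proof (intro allI impI \<Phi>)
    fix j assume j: "j < length Z"
    show "indet (Z ! j) \<in> carrier (poly_ring V :: 'k mpoly ring)"
      using Z nth_mem[OF j] by auto
  qed (use h zh in auto)
  moreover have "K_algebra_iso V J Y (contracted_ideal J Y) \<Phi>"
    unfolding \<Phi>_def by (rule contraction_iso[OF J Y red])
  moreover have "\<Phi> \<in> extensional (carrier (poly_ring V Quot J))" by (simp add: \<Phi>_def)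
  ultimately have iso: "is_separating_reembedding V J Z \<Phi>"
    unfolding is_separating_reembedding_def Let_def Y_def[symmetric]
    using \<sigma> h p gb by (intro conjI exI[of _ \<sigma>] exI[of _ h] exI[of _ p])
  show "is_separating_reembedding V J Z (separating_reembedding V J Z)"
    unfolding separating_reembedding_def
  proof (rule theI[where a = \<Phi>])
    show "is_separating_reembedding V J Z \<Phi>" by (rule iso)
    show "\<Phi>' = \<Phi>" if "is_separating_reembedding V J Z \<Phi>'" for \<Phi>'
      using is_separating_reembedding_imp_eq[OF J that] by (simp add: \<Phi>_def Y_def)
  qed
qed

section \<open>Cotangent equivalence classes and optimality\<close>

text \<open>Dimension count for the cotangent space, carried out upstairs: adjoin a basis of
  \<open>linear_part_space J\<close> to \<open>A\<close> and use that the indeterminates are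
  independent.\<close>

lemma card_le_of_spanning:
  fixes J :: "'k::field mpoly set"
  assumes fin: "finite V" and J: "ideal J (poly_ring V)" and A: "finite A"
    and span: "indet ` V \<subseteq> mpoly.span (A \<union> linear_part_space J)"
  shows "card V \<le> card A + mpoly.dim (linear_part_space J)"
proof -
  have indets: "indet ` V \<subseteq> mpoly.span (indet ` V :: 'k mpoly set)" by (rule mpoly.span_superset)
  obtain B where B: "B \<subseteq> linear_part_space J" "mpoly.independent B"
      "linear_part_space J \<subseteq> mpoly.span B" "card B = mpoly.dim (linear_part_space J)"
    by (rule mpoly.basis_exists)
  have "linear_part_space J \<subseteq> mpoly.span (indet ` V)"
    using linear_part_in_span_indets ideal_poly_ringD(1)[OF J]
    unfolding linear_part_space_eq[OF J] by blast
  \<comment> \<open>The linear parts lie in the span of finitely many indeterminates, which bounds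
    the size of an independent set.\<close>
  then have "finite B"
    using mpoly.independent_span_bound[OF finite_imageI[OF fin] B(2)] B(1) by blast
  have "linear_part_space J \<subseteq> mpoly.span (A \<union> B)"
    using B(3) mpoly.span_mono[of B "A \<union> B"] by blast
  moreover have "A \<subseteq> mpoly.span (A \<union> B)"
    using mpoly.span_superset[of "A \<union> B"] by blast
  ultimately have "mpoly.span (A \<union> linear_part_space J) \<subseteq> mpoly.span (A \<union> B)"
    by (intro mpoly.span_minimal mpoly.subspace_span) blast
  then have "card (indet ` V :: 'k mpoly set) \<le> card (A \<union> B)"
    using mpoly.independent_span_bound[OF _ independent_indets, of "A \<union> B" V] A \<open>finite B\<close> span by blast
  also have "\<dots> \<le> card A + card B" by (rule card_Un_le)
  finally show ?thesis
    using B(4) by (simp add: card_image inj_on_subset[OF inj_indet])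
qed

text \<open>Lift the generators of the target to polynomials \<open>y i\<close>. They generate P/J
  as an algebra, and by the Leibniz rule linear parts of polynomial expressions in the
  \<open>y i\<close> are combinations of the linear parts of the \<open>y i\<close>, even if these
  have constant terms. So their linear parts span modulo \<open>linear_part_space J\<close>.\<close>

lemma reembedding_card_le:
  fixes J :: "'k::field mpoly set"
  assumes fin: "finite V" and J: "ideal J (poly_ring V)" and \<psi>: "reembedding V J W J' \<psi>"
  shows "card V \<le> card W + mpoly.dim (linear_part_space J)"
proof -
  have J': "ideal J' (poly_ring W)" and finW: "finite W" and iso: "K_algebra_iso V J W J' \<psi>"
    using \<psi> by (auto simp: reembedding_def)
  define cl where "cl p = J +>\<^bsub>poly_ring V\<^esub> p" for p
  define cl' where "cl' p = J' +>\<^bsub>poly_ring W\<^esub> p" for p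
  have bij: "bij_betw \<psi> (cl ` carrier (poly_ring V)) (cl' ` carrier (poly_ring W))"
    using iso by (auto simp: K_algebra_iso_def ring_iso_def carrier_quot_poly_ring cl_def[abs_def] cl'_def[abs_def])
  have "\<exists>p\<in>carrier (poly_ring V). \<psi> (cl p) = cl' (indet i)" if "i \<in> W" for i
  proof -
    have "cl' (indet i) \<in> cl' ` carrier (poly_ring W)" using that by (intro imageI) simp
    then have "cl' (indet i) \<in> \<psi> ` cl ` carrier (poly_ring V)"
      by (simp only: bij_betw_imp_surj_on[OF bij])
    then obtain C where C: "C \<in> cl ` carrier (poly_ring V)" "cl' (indet i) = \<psi> C" by (rule imageE)
    from C(1) obtain p where "p \<in> carrier (poly_ring V)" "C = cl p" by (rule imageE)
    then show ?thesis using C(2) by auto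
  qed
  then have "\<forall>i\<in>W. \<exists>p. p \<in> carrier (poly_ring V) \<and> \<psi> (cl p) = cl' (indet i)" by blast
  from bchoice[OF this] obtain y where
    "\<forall>i\<in>W. y i \<in> carrier (poly_ring V) \<and> \<psi> (cl (y i)) = cl' (indet i)" ..
  then have y: "y i \<in> carrier (poly_ring V)" "\<psi> (cl (y i)) = cl' (indet i)" if "i \<in> W" for i
    using that by simp_all
  define A where "A = (\<lambda>i. linear_part (y i)) ` W"
  define S where "S = mpoly.span (A \<union> linear_part_space J)"
  have main: "\<exists>p\<in>carrier (poly_ring V). \<psi> (cl p) = cl' q \<and> linear_part p \<in> S" if "q \<in> carrier (poly_ring W)" for q
    using that
  proof (induction rule: poly_ring_induct)
    case (const c)
    have "\<psi> (cl (const c)) = cl' (const c)"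
      using iso unfolding K_algebra_iso_def cl_def cl'_def by blast
    then show ?case by (intro bexI[of _ "const c"]) (simp_all add: S_def mpoly.span_zero)
  next
    case (indet i)
    have "linear_part (y i) \<in> S"
      unfolding S_def A_def by (rule mpoly.span_base) (use indet in blast)
    then show ?case using y[OF indet] by (intro bexI[of _ "y i"]) simp_all
  next
    case (add p q)
    then obtain p' q' where *: "p' \<in> carrier (poly_ring V)" "\<psi> (cl p') = cl' p" "linear_part p' \<in> S"
      "q' \<in> carrier (poly_ring V)" "\<psi> (cl q') = cl' q" "linear_part q' \<in> S"
      by blast
    have "\<psi> (cl (p' + q')) = cl' (p + q)"
      using K_algebra_isoD(1)[OF iso, of "cl p'" "cl q'"] *
        quot_poly_ring_ops(1)[OF J *(1,4)] quot_poly_ring_ops(1)[OF J' add.hyps]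
      by (simp add: carrier_quot_poly_ring cl_def cl'_def)
    moreover have "linear_part (p' + q') \<in> S"
      using * unfolding S_def linear_part_add by (intro mpoly.span_add)
    ultimately show ?case using * by (intro bexI[of _ "p' + q'"]) simp_all
  next
    case (mult p q)
    then obtain p' q' where *: "p' \<in> carrier (poly_ring V)" "\<psi> (cl p') = cl' p" "linear_part p' \<in> S"
      "q' \<in> carrier (poly_ring V)" "\<psi> (cl q') = cl' q" "linear_part q' \<in> S"
      by blast
    have "\<psi> (cl (p' * q')) = cl' (p * q)"
      using K_algebra_isoD(2)[OF iso, of "cl p'" "cl q'"] *
        quot_poly_ring_ops(2)[OF J *(1,4)] quot_poly_ring_ops(2)[OF J' mult.hyps]
      by (simp add: carrier_quot_poly_ring cl_def cl'_def)
    moreover have "linear_part (p' * q') \<in> S"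
      using * unfolding S_def linear_part_mult by (intro mpoly.span_add mpoly.span_scale)
    ultimately show ?case using * by (intro bexI[of _ "p' * q'"]) simp_all
  qed
  have "indet i \<in> S" if i: "i \<in> V" for i
  proof -
    have i_carr: "indet i \<in> carrier (poly_ring V :: 'k mpoly ring)" using i by simp
    then have "\<psi> (cl (indet i)) \<in> cl' ` carrier (poly_ring W)"
      by (intro bij_betw_apply[OF bij] imageI)
    then obtain q where q: "\<psi> (cl (indet i)) = cl' q" "q \<in> carrier (poly_ring W)" by (rule imageE)
    obtain p where p: "p \<in> carrier (poly_ring V)" "\<psi> (cl p) = cl' q" "linear_part p \<in> S"
      using main[OF q(2)] by blast
    \<comment> \<open>Injectivity of \<psi> turns the representation by the \<open>y i\<close> into
      a congruence modulo \<open>J\<close>, which affects linear parts only by an element of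
      \<open>linear_part_space J\<close>.\<close>
    have "cl (indet i) = cl p"
    proof (rule inj_onD[OF bij_betw_imp_inj_on[OF bij]])
      show "\<psi> (cl (indet i)) = \<psi> (cl p)" by (simp only: q(1) p(2))
    qed (intro imageI i_carr p(1))+
    then have "indet i - p \<in> J" unfolding cl_def coset_eq_iff[OF J] .
    then have "linear_part (indet i - p) \<in> linear_part_space J"
      unfolding linear_part_space_eq[OF J] by (rule imageI)
    then have "indet i - linear_part p \<in> S"
      unfolding S_def by (intro mpoly.span_base) (simp add: linear_part_diff)
    from mpoly.span_add[OF this[unfolded S_def] p(3)[unfolded S_def]] show ?thesis
      by (simp add: S_def)
  qed
  then have "indet ` V \<subseteq> mpoly.span (A \<union> linear_part_space J)" unfolding S_def by blast
  moreover have "finite A" "card A \<le> card W"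
    using finW by (auto simp: A_def card_image_le)
  ultimately show ?thesis
    using card_le_of_spanning[OF fin J, of A] by simp
qed

text \<open>The common core of (a) and (b). If the class of \<open>x\<close> lay inside
  \<open>Z\<close>, the functional \<phi> below would vanish on \<open>J\<close>, yet not on an
  element whose leading term is the \<sigma>-least member of the class.\<close>

lemma nontrivial_class_meets_complement:
  fixes J :: "'k::field mpoly set"
  assumes fin: "finite V" and F: "F \<subseteq> irrelevant_ideal V" and J_gen: "J = Idl\<^bsub>poly_ring V\<^esub> F"
    and lin: "\<And>f. f \<in> F \<Longrightarrow> \<exists>a b. \<exists>i\<in>V. \<exists>j\<in>V. linear_part f = const a * indet i + const b * indet j"
    and sep: "separating V J Z" and Z: "set Z \<subseteq> V"
    and x: "x \<in> V" "indet x \<notin> linear_part_space J"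
  shows "\<exists>y. (x, y) \<in> cotangent_equiv V J \<and> y \<notin> set Z"
proof (rule ccontr)
  assume neg: "\<not> (\<exists>y. (x, y) \<in> cotangent_equiv V J \<and> y \<notin> set Z)"
  have F_carr: "F \<subseteq> carrier (poly_ring V)" using F by (auto simp: irrelevant_ideal_eq)
  have J: "ideal J (poly_ring V)" and F_J: "F \<subseteq> J"
    using genideal_poly_ring[OF F_carr] by (simp_all add: J_gen)
  have sub: "J \<subseteq> irrelevant_ideal V"
    unfolding J_gen by (rule genideal_poly_ring_minimal[OF ideal_irrelevant_ideal F])
  define L where "L = linear_part_space J"
  have L_add: "p + q \<in> L" if "p \<in> L" "q \<in> L" for p q
    using that unfolding L_def linear_part_space_def by (rule mpoly.span_add)
  have L_diff: "p - q \<in> L" if "p \<in> L" "q \<in> L" for p q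
    using that unfolding L_def linear_part_space_def by (rule mpoly.span_diff)
  have L_scale: "scale c p \<in> L" if "p \<in> L" for c p
    using that unfolding L_def linear_part_space_def by (rule mpoly.span_scale)
  note equiv_iff = cotangent_equiv_iff[OF J sub, folded L_def]
  define C where "C = {y. (x, y) \<in> cotangent_equiv V J}"
  have C_V: "C \<subseteq> V" by (auto simp: C_def cotangent_equiv_def)
  have C_Z: "C \<subseteq> set Z" using neg by (auto simp: C_def)
  have x_C: "x \<in> C" using x by (auto simp: C_def cotangent_equiv_def)
  have C_equiv: "(y, z) \<in> cotangent_equiv V J" if "y \<in> C" "z \<in> C" for y z
    using that by (auto simp: C_def cotangent_equiv_def)
  have C_closed: "z \<in> C" if "y \<in> C" "(y, z) \<in> cotangent_equiv V J" for y z
    using that by (auto simp: C_def cotangent_equiv_def)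
  have C_nontrivial: "indet y \<notin> L" if y: "y \<in> C" for y
  proof
    assume y_L: "indet y \<in> L"
    obtain c where c: "indet x - scale c (indet y) \<in> L"
      using C_equiv[OF x_C y] unfolding equiv_iff by blast
    have "indet x \<in> L" using L_add[OF c L_scale[OF y_L, of c]] by simp
    then show False using x(2) by (simp add: L_def)
  qed
  have C_scale: "c = 0" if "y \<in> C" "scale c (indet y) \<in> L" for c y
    using L_scale[OF that(2), of "1 / c"] C_nontrivial[OF that(1)] by (cases "c = 0") simp_all
  obtain \<sigma> where \<sigma>: "separating_for V \<sigma> J Z" using sep unfolding separating_def by blast
  then have ord: "term_ordering V \<sigma>" by (simp add: separating_for_def)
  obtain t where t: "t \<in> indet_pp ` C" "\<And>s. (s, t) \<in> \<sigma> - Id \<Longrightarrow> s \<notin> indet_pp ` C"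
    using wfE_min[OF wf_term_ordering[OF ord fin] imageI[OF x_C, of indet_pp]] by metis
  from t(1) obtain z where z: "z \<in> C" "t = indet_pp z" by blast
  \<comment> \<open>All members of the class are multiples of the chosen \<open>z\<close> modulo
    \<open>L\<close>; the factors \<open>l\<close> are the weights of the functional.\<close>
  have "\<forall>y\<in>C. \<exists>c. indet y - scale c (indet z) \<in> L"
    using C_equiv z(1) unfolding equiv_iff by blast
  then obtain l where l: "\<And>y. y \<in> C \<Longrightarrow> indet y - scale (l y) (indet z) \<in> L" by metis
  have fin_C: "finite C" using fin C_V finite_subset by blast
  define \<phi> where "\<phi> p = (\<Sum>y\<in>C. l y * coeff p (indet_pp y))" for p
  have \<phi>_add: "\<phi> (p + q) = \<phi> p + \<phi> q" for p q
    by (simp add: \<phi>_def lookup_add distrib_left sum.distrib)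
  have \<phi>_mult: "\<phi> (p * q) = coeff p 0 * \<phi> q + coeff q 0 * \<phi> p" for p q
    by (simp add: \<phi>_def coeff_mult_indet_pp distrib_left sum.distrib sum_distrib_left mult_ac)
  have \<phi>_indet: "\<phi> (indet i) = (if i \<in> C then l i else 0)" for i
    using fin_C by (simp add: \<phi>_def coeff_indet if_distrib[of "\<lambda>x. _ * x"] cong: if_cong)
  have \<phi>_const: "\<phi> (const c * p) = c * \<phi> p" for c p
    by (simp add: \<phi>_def sum_distrib_left mult.left_commute)
  \<comment> \<open>With \<open>a \<noteq> 0\<close> and \<open>i \<in> C\<close>, the relation
    would make the non-trivial \<open>i\<close> a multiple of \<open>j\<close> modulo
    \<open>L\<close> and so put \<open>j\<close> into the class. Hence no generator truly mixes
    \<open>C\<close> with its complement.\<close>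
  have one_sided: "a * \<phi> (indet i) = 0"
    if ij: "i \<in> V" "j \<in> V" "scale a (indet i) + scale b (indet j) \<in> L" "j \<notin> C" for a b i j
  proof (rule ccontr)
    assume "a * \<phi> (indet i) \<noteq> 0"
    then have a: "a \<noteq> 0" and i: "i \<in> C" by (auto simp: \<phi>_indet split: if_splits)
    have diff: "indet i - scale (- (b / a)) (indet j) \<in> L"
      using L_scale[OF ij(3), of "1 / a"] a by (simp add: mpoly.scale_right_distrib)
    have "(i, j) \<in> cotangent_equiv V J"
      by (rule nontrivial_cotangent_equivI[OF J sub ij(1,2) C_nontrivial[OF i, unfolded L_def] diff[unfolded L_def]])
    then show False using C_closed[OF i] ij(4) by blast
  qed
  have \<phi>_F: "\<phi> f = 0" if f: "f \<in> F" for f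
  proof -
    obtain a b i j where ij: "i \<in> V" "j \<in> V" "linear_part f = scale a (indet i) + scale b (indet j)"
      using lin[OF f] by (auto simp: scale_def)
    have "linear_part f \<in> L" using f F_J by (auto simp: L_def linear_part_space_eq[OF J])
    then have L: "scale a (indet i) + scale b (indet j) \<in> L" by (simp add: ij(3))
    then have L': "scale b (indet j) + scale a (indet i) \<in> L" by (simp add: add.commute)
    have "\<phi> f = \<phi> (linear_part f)" by (auto simp: \<phi>_def coeff_linear_part intro!: sum.cong)
    also have "\<dots> = a * \<phi> (indet i) + b * \<phi> (indet j)"
      by (simp add: ij(3) \<phi>_add \<phi>_const scale_def)
    also have "\<dots> = 0"
    proof (cases "i \<in> C \<and> j \<in> C")
      case True
      \<comment> \<open>Replacing both indeterminates by their multiples of \<open>z\<close> gives a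
        multiple of \<open>z\<close> in \<open>L\<close>; as \<open>z\<close> is non-trivial, its
        factor, the value of \<phi>, is 0.\<close>
      have "scale a (indet i) + scale b (indet j) -
          (scale a (indet i - scale (l i) (indet z)) + scale b (indet j - scale (l j) (indet z))) \<in> L"
        using True by (intro L_diff L L_add L_scale l) simp_all
      then have "scale (a * l i + b * l j) (indet z) \<in> L"
        by (simp add: mpoly.scale_right_diff_distrib mpoly.scale_left_distrib)
      then have "a * l i + b * l j = 0" by (rule C_scale[OF z(1)])
      then show ?thesis using True by (simp add: \<phi>_indet)
    next
      case False
      then consider "i \<notin> C" "j \<notin> C" | "i \<in> C" "j \<notin> C" | "i \<notin> C" "j \<in> C" by blast
      then show ?thesis
      proof cases
        case 1
        then show ?thesis by (simp add: \<phi>_indet)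
      next
        case 2
        then show ?thesis using one_sided[OF ij(1,2) L] by (simp add: \<phi>_indet)
      next
        case 3
        then show ?thesis using one_sided[OF ij(2,1) L'] by (simp add: \<phi>_indet)
      qed
    qed
    finally show ?thesis .
  qed
  \<comment> \<open>Requiring the constant term to vanish as well makes the kernel of \<phi> an
    ideal, by the Leibniz rule; so \<phi> vanishes on all of \<open>J\<close> and not only on the
    generators.\<close>
  have "ideal {p \<in> carrier (poly_ring V). coeff p 0 = 0 \<and> \<phi> p = 0} (poly_ring V)"
    by (rule ideal_poly_ringI) (auto simp: \<phi>_add \<phi>_mult lookup_add, simp add: \<phi>_def)
  moreover have "F \<subseteq> {p \<in> carrier (poly_ring V). coeff p 0 = 0 \<and> \<phi> p = 0}"
    using \<phi>_F F by (auto simp: irrelevant_ideal_eq)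
  ultimately have \<phi>_J: "\<phi> g = 0" if "g \<in> J" for g
    using genideal_poly_ring_minimal that unfolding J_gen by blast
  obtain j where j: "j < length Z" "Z ! j = z"
    using subsetD[OF C_Z z(1)] unfolding in_set_conv_nth by blast
  have "\<exists>g\<in>J - {0}. LT \<sigma> g = indet_pp (Z ! j)"
    using \<sigma> j(1) unfolding separating_for_def by blast
  then obtain g where g: "g \<in> J" "g \<noteq> 0" "LT \<sigma> g = t"
    unfolding j(2) z(2) by blast
  have "g \<in> carrier (poly_ring V)" using g(1) ideal_poly_ringD(1)[OF J] by blast
  note lt = LT_props[OF ord fin this g(2), unfolded g(3)]
  \<comment> \<open>The other members of the class are \<sigma>-larger than the leading term of
    \<open>g\<close>, so only \<open>z\<close> contributes to the value of \<phi> at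
    \<open>g\<close>.\<close>
  have "coeff g (indet_pp y) = 0" if y: "y \<in> C - {z}" for y
  proof (rule ccontr)
    assume "coeff g (indet_pp y) \<noteq> 0"
    then have "(indet_pp y, t) \<in> \<sigma>" by (intro lt(2)) (simp add: in_keys_iff)
    moreover have "indet_pp y \<noteq> t" using y by (simp add: z(2))
    ultimately show False using t(2) y by blast
  qed
  then have "\<phi> g = l z * coeff g (indet_pp z)"
    unfolding \<phi>_def using fin_C z(1) by (simp add: sum.remove[of C z])
  moreover have "coeff g (indet_pp z) \<noteq> 0" using lt(1) by (simp add: z(2) in_keys_iff)
  moreover have "l z \<noteq> 0"
    using l[OF z(1)] C_nontrivial[OF z(1)] by auto
  ultimately show False using \<phi>_J[OF g(1)] by simp
qed

text \<open>The indeterminates outside \<open>Z\<close> span modulo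
  \<open>linear_part_space J\<close>, and by \<open>dim\<close> their number is the dimension of
  that quotient; a redundant \<open>y\<close> would contradict the count.\<close>

lemma complement_indet_not_in_span:
  fixes J :: "'k::field mpoly set"
  assumes fin: "finite V" and J: "ideal J (poly_ring V)" and sub: "J \<subseteq> irrelevant_ideal V"
    and Z: "distinct Z" "set Z \<subseteq> V" and sep: "separating V J Z"
    and dim: "length Z = mpoly.dim (linear_part_space J)" and y: "y \<in> V - set Z"
  shows "indet y \<notin> mpoly.span (indet ` (V - set Z - {y}) \<union> linear_part_space J)"
proof
  let ?L = "linear_part_space J"
  define A :: "'k mpoly set" where "A = indet ` (V - set Z - {y})"
  assume "indet y \<in> mpoly.span (indet ` (V - set Z - {y}) \<union> ?L)"
  then have y_span: "indet y \<in> mpoly.span (A \<union> ?L)" by (simp add: A_def)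
  have "indet i \<in> mpoly.span (A \<union> ?L)" if "i \<in> V - set Z" for i
    using that y_span by (cases "i = y") (auto simp: A_def intro: mpoly.span_base)
  then have Y_span: "mpoly.span (indet ` (V - set Z)) \<subseteq> mpoly.span (A \<union> ?L)"
    by (intro mpoly.span_minimal mpoly.subspace_span) blast
  \<comment> \<open>Each indeterminate is congruent modulo \<open>J\<close> to a polynomial in the
    indeterminates outside \<open>Z\<close>; comparing linear parts gives the spanning
    property.\<close>
  have "indet i \<in> mpoly.span (A \<union> ?L)" if i: "i \<in> V" for i
  proof -
    obtain q where q: "q \<in> carrier (poly_ring (V - set Z))" "indet i - q \<in> J"
      using separating_reembedding_correct(2)[OF fin J sub Z(2) sep i] by blast
    have "linear_part (indet i - q) \<in> ?L"
      unfolding linear_part_space_eq[OF J] by (rule imageI[OF q(2)])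
    then have "indet i - linear_part q \<in> mpoly.span (A \<union> ?L)"
      by (intro mpoly.span_base) (simp add: linear_part_diff)
    moreover have "linear_part q \<in> mpoly.span (A \<union> ?L)"
      using linear_part_in_span_indets[OF q(1)] Y_span by blast
    ultimately show ?thesis using mpoly.span_add by fastforce
  qed
  then have "indet ` V \<subseteq> mpoly.span (A \<union> ?L)" by blast
  moreover have "finite A" using fin by (simp add: A_def)
  ultimately have "card V \<le> card A + length Z"
    using card_le_of_spanning[OF fin J, of A] dim by simp
  moreover have "card A < card (V - set Z)"
  proof -
    have "card A \<le> card (V - set Z - {y})" unfolding A_def by (rule card_image_le) (simp add: fin)
    also have "\<dots> < card (V - set Z)" using y fin by (intro psubset_card_mono) auto
    finally show ?thesis .
  qed
  moreover have "card (V - set Z) + length Z = card V"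
    using Z fin by (metis card_Diff_subset distinct_card List.finite_set card_mono le_add_diff_inverse2)
  ultimately show False by linarith
qed

theorem theorem5p6:
  fixes n r :: nat
    and f :: "nat \<Rightarrow> 'k::field mpoly"
    and X Y :: "nat set"
    and I :: "'k mpoly set"
    and Z :: "nat list"
  assumes X: "X = {1..n}"
    and f_in: "\<forall>i\<in>{1..r}. f i \<in> irrelevant_ideal X"
    and lin: "\<forall>i\<in>{1..r}. \<exists>a b. \<exists>i1\<in>{1..n}. \<exists>i2\<in>{1..n}.
                linear_part (f i) = const a * indet i1 + const b * indet i2"
    and I: "I = Idl\<^bsub>poly_ring X\<^esub> (f ` {1..r})"
    and Z_indets: "distinct Z" "set Z \<subseteq> X" "length Z \<ge> 1"
    and Z_sep: "separating X I Z"
    and Y: "Y = X - set Z"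
  shows "basic_indets X I \<subseteq> Y \<and>
    (\<forall>C\<in>proper_classes X I. \<exists>y\<in>C. y \<in> Y) \<and>
    (length Z = mpoly.dim (linear_part_space I) \<longrightarrow>
      optimal_reembedding X I Y (contracted_ideal I Y) (separating_reembedding X I Z) \<and>
      trivial_indets X I \<subseteq> set Z \<and>
      (\<forall>C\<in>proper_classes X I. \<exists>!y. y \<in> C \<and> y \<in> Y))"
proof -
  have fin: "finite X" by (simp add: X)
  have F: "f ` {1..r} \<subseteq> irrelevant_ideal X" using f_in by blast
  then have F_carr: "f ` {1..r} \<subseteq> carrier (poly_ring X)" by (auto simp: irrelevant_ideal_eq)
  have ideal: "ideal I (poly_ring X)" unfolding I by (rule genideal_poly_ring(1)[OF F_carr])
  have sub: "I \<subseteq> irrelevant_ideal X"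
    unfolding I by (rule genideal_poly_ring_minimal[OF ideal_irrelevant_ideal F])
  note trivial_iff = trivial_indets_iff[OF ideal sub]
  have meets: "\<exists>y. (x, y) \<in> cotangent_equiv X I \<and> y \<in> Y" if x: "x \<in> X" "x \<notin> trivial_indets X I" for x
  proof -
    have "indet x \<notin> linear_part_space I" using x by (simp add: trivial_iff)
    then obtain y where "(x, y) \<in> cotangent_equiv X I" "y \<notin> set Z"
      using nontrivial_class_meets_complement[OF fin F I _ Z_sep Z_indets(2) x(1)] lin
      unfolding X by blast
    then show ?thesis using Y by (auto simp: cotangent_equiv_def)
  qed
  have "basic_indets X I \<subseteq> Y"
  proof
    fix x assume "x \<in> basic_indets X I"
    then have x: "x \<in> X" "x \<notin> trivial_indets X I" "cotangent_equiv X I `` {x} = {x}"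
      by (auto simp: basic_indets_def)
    obtain y where y: "(x, y) \<in> cotangent_equiv X I" "y \<in> Y" using meets[OF x(1,2)] by blast
    from y(1) have "y \<in> cotangent_equiv X I `` {x}" by blast
    then have "y = x" by (simp only: x(3) singleton_iff)
    then show "x \<in> Y" using y(2) by simp
  qed
  moreover have classes: "\<exists>y\<in>C. y \<in> Y" if "C \<in> proper_classes X I" for C
  proof -
    have "C \<in> X // cotangent_equiv X I" and nt: "C \<inter> trivial_indets X I = {}"
      using that by (auto simp: proper_classes_def)
    then obtain x where x: "x \<in> X" "C = cotangent_equiv X I `` {x}" by (auto elim: quotientE)
    then have "x \<in> C" by (auto simp: cotangent_equiv_def)
    then have "x \<notin> trivial_indets X I" using nt by blast
    with meets[OF x(1)] show ?thesis unfolding x(2) by blast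
  qed
  moreover have "optimal_reembedding X I Y (contracted_ideal I Y) (separating_reembedding X I Z) \<and>
      trivial_indets X I \<subseteq> set Z \<and> (\<forall>C\<in>proper_classes X I. \<exists>!y. y \<in> C \<and> y \<in> Y)"
    if dim: "length Z = mpoly.dim (linear_part_space I)"
  proof (intro conjI ballI)
    have Y_X: "Y \<subseteq> X" using Y by blast
    note span = complement_indet_not_in_span[OF fin ideal sub Z_indets(1,2) Z_sep dim, folded Y]
    have "is_separating_reembedding X I Z (separating_reembedding X I Z)"
      by (rule separating_reembedding_correct(1)[OF fin ideal sub Z_indets(2) Z_sep])
    then have "K_algebra_iso X I Y (contracted_ideal I Y) (separating_reembedding X I Z)"
      unfolding is_separating_reembedding_def Let_def Y by blast
    then have "reembedding X I Y (contracted_ideal I Y) (separating_reembedding X I Z)"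
      using fin Y_X ideal_contracted_ideal[OF ideal Y_X] finite_subset by (auto simp: reembedding_def)
    \<comment> \<open>Any re-embedding needs at least as many indeterminates as the dimension of the
      cotangent space, and \<open>dim\<close> makes this the cardinality of
      \<open>Y\<close>.\<close>
    moreover have "krull_dim (poly_ring Y :: 'k mpoly ring) \<le> krull_dim (poly_ring W :: 'k mpoly ring)"
      if W: "reembedding X I W J \<psi>" for W J \<psi>
    proof (rule krull_dim_poly_ring_mono)
      show "finite Y" using fin Y_X finite_subset by blast
      show "finite W" using W by (simp add: reembedding_def)
      have "card Y = card X - length Z"
        unfolding Y using Z_indets(1,2) by (simp add: card_Diff_subset distinct_card)
      also have "\<dots> \<le> card W" using reembedding_card_le[OF fin ideal W] dim by simp
      finally show "card Y \<le> card W" .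
    qed
    ultimately show "optimal_reembedding X I Y (contracted_ideal I Y) (separating_reembedding X I Z)"
      unfolding optimal_reembedding_def by blast
    show "trivial_indets X I \<subseteq> set Z"
    proof
      fix x assume "x \<in> trivial_indets X I"
      then have x: "x \<in> X" "indet x \<in> linear_part_space I" by (simp_all add: trivial_iff)
      show "x \<in> set Z"
      proof (rule ccontr)
        assume "x \<notin> set Z"
        then have "x \<in> Y" using x(1) Y by blast
        \<comment> \<open>A trivial indeterminate lies in the space of linear parts itself, hence in
          the span that an element of \<open>Y\<close> avoids.\<close>
        then show False using span[of x] x(2) by (auto intro: mpoly.span_base)
      qed
    qed
    show "\<exists>!y. y \<in> C \<and> y \<in> Y" if C: "C \<in> proper_classes X I" for C
    proof -
      obtain y where y: "y \<in> C" "y \<in> Y" using classes[OF C] by blast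
      have "C \<in> X // cotangent_equiv X I" using C by (simp add: proper_classes_def)
      then have equiv: "(y', y) \<in> cotangent_equiv X I" if "y' \<in> C" for y'
        using that y(1) by (auto elim!: quotientE simp: cotangent_equiv_def)
      have "y' = y" if y': "y' \<in> C" "y' \<in> Y" for y'
      \<comment> \<open>Two distinct equivalent elements of \<open>Y\<close> would be proportional
        modulo the space of linear parts, so one would lie in the span of the remaining
        ones.\<close>
      proof (rule ccontr)
        assume neq: "y' \<noteq> y"
        obtain c where c: "indet y' - scale c (indet y) \<in> linear_part_space I"
          using equiv[OF y'(1)] unfolding cotangent_equiv_iff[OF ideal sub] by blast
        let ?S = "mpoly.span (indet ` (Y - {y'}) \<union> linear_part_space I)"
        have "indet y \<in> ?S" using y(2) neq by (intro mpoly.span_base) blast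
        then have "scale c (indet y) \<in> ?S" by (rule mpoly.span_scale)
        moreover have "indet y' - scale c (indet y) \<in> ?S" using c by (intro mpoly.span_base) blast
        ultimately have "indet y' \<in> ?S" using mpoly.span_add by fastforce
        then show False using span y'(2) Y by blast
      qed
      then show ?thesis using y by blast
    qed
  qed
  ultimately show ?thesis by blast
qed

end
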